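(* Consider a solution $(p,q,r,\gamma_1,\gamma_2,\gamma_3)(t)$ of the Goryachev-Chaplygin system $$4\dot p - 3qr = 0,\quad 4\dot q + 3rp = \gamma_3,\quad \dot r = -\gamma_2,\quad \dot\gamma_1 = r\gamma_2 - q\gamma_3,\quad \dot\gamma_2 = p\gamma_3 - r\gamma_1,\quad \dot\gamma_3 = q\gamma_1 - p\gamma_2,$$ with $\gamma_1^2+\gamma_2^2+\gamma_3^2=1$ and zero area integral $4(p\gamma_1+q\gamma_2)+r\gamma_3=0$. Let $h=2(p^2+q^2)+\tfrac12r^2+\gamma_1$ and $k=r(p^2+q^2)-p\gamma_3$ be the values of the other two first integrals on this solution. Suppose that $$h\ne 2k^2,\qquad k\ne 0,\qquad h\ne\tfrac32|2k|^{2/3}+1,\qquad h\ne\tfrac32|2k|^{2/3}-1,$$ and that the frequencies of the motion on the two-dimensional invariant torus containing the solution are rationally independent. Then the line of nodes has the main motion $\Lambda=0$, that is, the precession angle $\psi$ along the solution satisfies $\lim_{t\to+\infty}\psi(t)/t=0$.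
   Context: Here $(p,q,r,\gamma_1,\gamma_2,\gamma_3)\in\mathbb{R}^6$. The four first integrals are $2(p^2+q^2)+\tfrac12r^2+\gamma_1=h$, $4(p\gamma_1+q\gamma_2)+r\gamma_3=0$ (the area integral; integrability holds only on its zero level), $r(p^2+q^2)-p\gamma_3=k$, and $\gamma_1^2+\gamma_2^2+\gamma_3^2=1$. When $k\neq0$ and $h\ne\frac32|2k|^{2/3}\pm1$, the first integrals are functionally independent on their common level set, each of whose connected components is a two-dimensional torus invariant under the flow. On each torus there are angle coordinates $\varphi_1,\varphi_2$ (mod $2\pi$) in which the flow is $\dot\varphi_i=\omega_i$ with constant frequencies $\omega_1,\omega_2$; rationally independent means linearly independent over $\mathbb{Q}$. Precession angle (angle of the line of nodes): set $\Psi(t)=\dfrac{p\gamma_1+q\gamma_2}{\gamma_1^2+\gamma_2^2}$ evaluated along the solution. If the solution passes through a point with $\gamma_3=\pm1$ at time $t'$, then $\Psi(t')$ is defined as the limit $\lim_{t\to t'}\Psi(t)$ (which exists by l'Hopital's rule). Then $\psi(t)=\psi(t_0)+\int_{t_0}^t\Psi(s)\,ds$. Main motion: a function $\psi(t)$ has main motion $\Lambda$ if $\psi(t)=\psi(0)+\Lambda t+o(t)$ as $t\to+\infty$, i.e. $\lim_{t\to+\infty}\psi(t)/t=\Lambda$. *)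

theory Defs
  imports "HOL-Analysis.Analysis" "HOL-Library.Landau_Symbols"
begin

text \<open>A state is a tuple \<open>(p, q, r, \<gamma>\<^sub>1, \<gamma>\<^sub>2, \<gamma>\<^sub>3)\<close>.\<close>

type_synonym state = "real \<times> real \<times> real \<times> real \<times> real \<times> real"

text \<open>The Goryachev-Chaplygin equations \<open>4p' - 3qr = 0\<close>, \<open>4q' + 3rp = \<gamma>\<^sub>3\<close>, ..., solved for the
  derivatives.\<close>

fun gc_field :: "state \<Rightarrow> state" where
  "gc_field (p, q, r, g1, g2, g3) =
     (3 * q * r / 4, (g3 - 3 * r * p) / 4, - g2, r * g2 - q * g3, p * g3 - r * g1, q * g1 - p * g2)"

definition gc_solution :: "(real \<Rightarrow> state) \<Rightarrow> bool" where
  "gc_solution x \<longleftrightarrow> (\<forall>t. (x has_vector_derivative gc_field (x t)) (at t))"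

fun energy :: "state \<Rightarrow> real" where
  "energy (p, q, r, g1, g2, g3) = 2 * (p\<^sup>2 + q\<^sup>2) + r\<^sup>2 / 2 + g1"

fun area_integral :: "state \<Rightarrow> real" where
  "area_integral (p, q, r, g1, g2, g3) = 4 * (p * g1 + q * g2) + r * g3"

fun gc_integral :: "state \<Rightarrow> real" where
  "gc_integral (p, q, r, g1, g2, g3) = r * (p\<^sup>2 + q\<^sup>2) - p * g3"

fun geometric_integral :: "state \<Rightarrow> real" where
  "geometric_integral (p, q, r, g1, g2, g3) = g1\<^sup>2 + g2\<^sup>2 + g3\<^sup>2"

definition level_set :: "real \<Rightarrow> real \<Rightarrow> state set" where
  "level_set h k =
     {x. energy x = h \<and> area_integral x = 0 \<and> gc_integral x = k \<and> geometric_integral x = 1}"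

text \<open>Angle coordinates on an invariant torus \<open>T\<close>, given by the inverse chart \<open>\<Phi>\<close>: a C1 immersion
  of the plane of angles onto \<open>T\<close> which is injective exactly up to adding multiples of \<open>2\<pi>\<close> to
  each angle, i.e. a C1 diffeomorphism of the standard torus onto \<open>T\<close>.  In these coordinates the
  flow is \<open>\<phi>\<^sub>i' = \<omega>\<^sub>i\<close>.\<close>

definition angle_coordinates ::
    "state set \<Rightarrow> (real \<times> real \<Rightarrow> state) \<Rightarrow> real \<Rightarrow> real \<Rightarrow> bool" where
  "angle_coordinates T \<Phi> \<omega>1 \<omega>2 \<longleftrightarrow>
     range \<Phi> = T \<and>
     (\<exists>D. (\<forall>a. (\<Phi> has_derivative D a) (at a) \<and> inj (D a)) \<and>
          (\<forall>v. continuous_on UNIV (\<lambda>a. D a v))) \<and>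
     (\<forall>a1 a2 b1 b2. \<Phi> (a1, a2) = \<Phi> (b1, b2) \<longleftrightarrow>
        (\<exists>m n :: int. a1 - b1 = 2 * pi * of_int m \<and> a2 - b2 = 2 * pi * of_int n)) \<and>
     (\<forall>a1 a2. gc_solution (\<lambda>t. \<Phi> (a1 + \<omega>1 * t, a2 + \<omega>2 * t)))"

definition rationally_independent :: "real \<Rightarrow> real \<Rightarrow> bool" where
  "rationally_independent \<omega>1 \<omega>2 \<longleftrightarrow>
     (\<forall>a\<in>\<rat>. \<forall>b\<in>\<rat>. a * \<omega>1 + b * \<omega>2 = 0 \<longrightarrow> a = 0 \<and> b = 0)"

fun gamma3 :: "state \<Rightarrow> real" where
  "gamma3 (p, q, r, g1, g2, g3) = g3"

fun node_rate :: "state \<Rightarrow> real" where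
  "node_rate (p, q, r, g1, g2, g3) = (p * g1 + q * g2) / (g1\<^sup>2 + g2\<^sup>2)"

definition precession_rate :: "(real \<Rightarrow> state) \<Rightarrow> real \<Rightarrow> real" where
  "precession_rate x t =
     (if gamma3 (x t) = 1 \<or> gamma3 (x t) = - 1 then Lim (at t) (\<lambda>s. node_rate (x s))
      else node_rate (x t))"

text \<open>The interval integral is signed, so \<open>t < t0\<close> is covered as well.\<close>

definition precession_angle :: "(real \<Rightarrow> state) \<Rightarrow> real \<Rightarrow> real \<Rightarrow> real \<Rightarrow> real" where
  "precession_angle x t0 \<psi>0 t = \<psi>0 + (LBINT s=ereal t0..ereal t. precession_rate x s)"

definition has_main_motion :: "(real \<Rightarrow> real) \<Rightarrow> real \<Rightarrow> bool" where
  "has_main_motion \<psi> \<Lambda> \<longleftrightarrow> (\<lambda>t. \<psi> t - \<psi> 0 - \<Lambda> * t) \<in> o[at_top](\<lambda>t. t)"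

end

theory Submission
  imports Defs
begin

text \<open>
  The involution \<open>(p, q, r, \<gamma>\<^sub>1, \<gamma>\<^sub>2, \<gamma>\<^sub>3) \<mapsto> (-p, -q, r, \<gamma>\<^sub>1, \<gamma>\<^sub>2, -\<gamma>\<^sub>3)\<close> commutes with the
  flow and changes the sign of the precession rate.  It maps every component of a level set with
  \<open>k \<noteq> 0\<close> to itself: in Chaplygin's separation variables the level set is a double cover whose deck
  transformation is this involution, and a full turn of one of the two angles lifts to a path that
  interchanges the sheets.  The frequencies being rationally independent, there are hence times \<open>\<tau>\<close>
  for which \<open>x(t + \<tau>)\<close> is close to the mirror image of \<open>x(t)\<close> uniformly in \<open>t\<close>, so that the precession
  over \<open>[t, t + N]\<close> and that over \<open>[t + \<tau>, t + \<tau> + N]\<close> almost cancel.  The precession rate is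
  unbounded near the finitely many points \<open>\<gamma>\<^sub>3 = \<plusminus>1\<close> of the torus.  There the line of nodes turns by
  a bounded angle during each passage, and passages close to such a point are separated by
  arbitrarily long times because the flow on the torus has no periodic orbits.
\<close>

subsection \<open>Invariance of the tori under the involution\<close>

text \<open>Equidistribution cannot be applied to the rate directly. Off the poles the rate is
  \<open>n / Y\<close> with \<open>n^2 + m^2 = a Y\<close>, so it is only controlled by the inverse
  square root of \<open>Y\<close>: it is no continuous function on the torus, and the statement
  concerns every single trajectory, including those that run through a pole. The average is
  therefore never formed; two windows of the same trajectory are compared instead. What makes this
  work is the order of the choices. A cell length \<delta> and a bound \<open>C\<close> for the
  turning within one cell are fixed once and for all. Only then come the tolerance \<eta> and the
  number \<open>L\<close> of cells in a window, after these a radius \<rho> so small that each pole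
  disturbs at most three cells of a window, and last the shift \<tau>. The disturbed cells
  contribute a constant that involves neither \<open>L\<close> nor \<eta>, so long windows make it
  negligible.\<close>

fun mirror :: "state \<Rightarrow> state" where
  "mirror (p, q, r, g1, g2, g3) = (- p, - q, r, g1, g2, - g3)"

lemma node_rate_mirror: "node_rate (mirror y) = - node_rate y"
  by (cases y) (simp add: divide_simps)

lemma mirror_mirror [simp]: "mirror (mirror y) = y"
  by (cases y) simp

lemma level_set_mirror: "mirror y \<in> level_set h k \<longleftrightarrow> y \<in> level_set h k"
  by (cases y) (auto simp: level_set_def)

text \<open>For \<open>k > 0\<close> both nonconstant terms decrease strictly on
  \<open>s > 0\<close>, and the function falls from plus to minus infinity. Hence \<open>cos\<close>
  \<theta> determines \<open>s\<close>, and \<open>s\<close> can follow \<theta> continuously around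
  the whole circle. On the negative half-line monotonicity fails, which is why the positive root is
  the one that gets turned.\<close>

lemma separation_function_inverse:
  fixes h k :: real
  assumes k: "k > 0"
  obtains G where "continuous_on {-1..1} G" "\<And>c. c \<in> {-1..1} \<Longrightarrow> G c > 0"
    "\<And>c. c \<in> {-1..1} \<Longrightarrow> h + 2 * k / G c - (G c)\<^sup>2 / 2 = c"
    "\<And>s. s > 0 \<Longrightarrow> h + 2 * k / s - s\<^sup>2 / 2 \<in> {-1..1} \<Longrightarrow> G (h + 2 * k / s - s\<^sup>2 / 2) = s"
proof -
  define g where "g = (\<lambda>s. h + 2 * k / s - s\<^sup>2 / 2)"
  have dec: "g t < g s" if "0 < s" "s < t" for s t
  proof -
    have "2 * k / t < 2 * k / s" using that k by (intro divide_strict_left_mono) auto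
    moreover have "s\<^sup>2 < t\<^sup>2" using that by (intro power_strict_mono) auto
    ultimately show ?thesis unfolding g_def by linarith
  qed
  have inj: "s = t" if "0 < s" "0 < t" "g s = g t" for s t
    using dec[of s t] dec[of t s] that by (cases s t rule: linorder_cases) auto
  \<comment> \<open>At \<open>lo\<close> the term \<open>2 * k / s\<close> is at least
    \<open>\<bar>h\<bar> + 2\<close>, which beats \<open>h\<close> and the square; at
    \<open>hi\<close> that term is at most 1 and the square dominates. So the range of
    \<open>g\<close> over \<open>{lo..hi}\<close> covers \<open>{-1..1}\<close>.\<close>
  define lo where "lo = min 1 (2 * k / (\<bar>h\<bar> + 2))"
  define hi where "hi = 2 * k + 2 * \<bar>h\<bar> + 4"
  have lo: "0 < lo" "lo \<le> 1" using k by (auto simp: lo_def)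
  have "lo \<le> 2 * k / (\<bar>h\<bar> + 2)" by (simp add: lo_def)
  then have "\<bar>h\<bar> + 2 \<le> 2 * k / lo" using lo by (simp add: field_simps)
  moreover have "lo\<^sup>2 \<le> 1" using lo by (simp add: power_le_one)
  ultimately have glo: "g lo \<ge> 1" unfolding g_def by linarith
  have hi: "hi \<ge> 4" using k by (simp add: hi_def)
  have "2 * k / hi \<le> 1" using k hi by (simp add: hi_def)
  moreover have "4 * hi \<le> hi\<^sup>2" using hi by (simp add: power2_eq_square)
  ultimately have ghi: "g hi \<le> -1" using k hi_def unfolding g_def by linarith
  have cont: "continuous_on {lo..hi} g"
    using lo unfolding g_def by (intro continuous_intros) auto
  define G where "G = inv_into {lo..hi} g"
  have inj': "inj_on g {lo..hi}" using inj lo by (auto simp: inj_on_def)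
  have sub: "{-1..1} \<subseteq> g ` {lo..hi}"
  proof
    fix c :: real assume "c \<in> {-1..1}"
    then have "\<exists>x\<ge>lo. x \<le> hi \<and> g x = c"
      using glo ghi lo hi cont by (intro IVT2') auto
    then show "c \<in> g ` {lo..hi}" by auto
  qed
  have "continuous_on (g ` {lo..hi}) G"
    using cont by (rule continuous_on_inv) (auto simp: G_def inj')
  then have "continuous_on {-1..1} G" using sub continuous_on_subset by blast
  moreover have in': "G c \<in> {lo..hi}" if "c \<in> {-1..1}" for c
    unfolding G_def using sub that by (intro inv_into_into) auto
  moreover have gG: "g (G c) = c" if "c \<in> {-1..1}" for c
    unfolding G_def using sub that by (intro f_inv_into_f) auto
  moreover have "G (g s) = s" if "s > 0" "g s \<in> {-1..1}" for s
    using inj[of "G (g s)" s] in'[of "g s"] gG[of "g s"] that lo by auto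
  ultimately show ?thesis using lo by (intro that[of G]) (fastforce simp: g_def)+
qed

text \<open>Chaplygin's separation variables: \<open>s > 0 > s2\<close> are the roots of \<open>X\<^sup>2 - r X - 4 (p\<^sup>2 + q\<^sup>2)\<close>,
  and \<open>(\<gamma>\<^sub>1 + \<i> \<gamma>\<^sub>2) - 2 \<gamma>\<^sub>3 (p + \<i> q) / s\<close> is the unit number \<open>exp (\<i> \<theta>)\<close>.\<close>

definition separation_state :: "real \<Rightarrow> real \<Rightarrow> real \<Rightarrow> real \<Rightarrow> state" where
  "separation_state s2 \<theta>2 s \<theta> =
    (let b = sqrt (- s * s2) / 2; \<alpha> = (\<theta> + \<theta>2) / 2; \<beta> = (\<theta> - \<theta>2) / 2 in
     (- b * sin \<alpha>, b * cos \<alpha>, s + s2, (s * cos \<theta> - s2 * cos \<theta>2) / (s - s2),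
      (s * sin \<theta> - s2 * sin \<theta>2) / (s - s2), - 4 * b * sin \<beta> / (s - s2)))"

text \<open>The components \<open>p\<close>, \<open>q\<close> and \<open>g3\<close> involve \<theta>
  only through half-angles, and both half-angles move by \<open>pi\<close>; the other three
  components are periodic. This is the interchange of the two sheets.\<close>

lemma separation_state_add_2pi:
  "separation_state s2 \<theta>2 s (\<theta> + 2 * pi) = mirror (separation_state s2 \<theta>2 s \<theta>)"
proof -
  have shift: "(\<theta> + 2 * pi + \<theta>2) / 2 = (\<theta> + \<theta>2) / 2 + pi" "(\<theta> + 2 * pi - \<theta>2) / 2 = (\<theta> - \<theta>2) / 2 + pi"
    by (auto simp: field_simps)
  show ?thesis
    unfolding separation_state_def Let_def shift by simp
qed

text \<open>The two cosine conditions say that \<open>s * cos\<close> \<theta> and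
  \<open>s2 * cos\<close> \<theta>\<open>2\<close> are values of one cubic,
  \<open>h X + 2 k - X^3 / 2\<close>, at \<open>s\<close> and \<open>s2\<close>. Its divided
  difference is \<open>g1\<close> and yields the energy; the combination that cancels the linear
  term yields \<open>k\<close>. The area and geometric integrals need only trigonometric identities.
  All four are checked after multiplication by a power of \<open>d\<close>.\<close>

lemma separation_state_level_set:
  assumes s: "s > 0" "s2 < 0"
    and c: "cos \<theta> = h + 2 * k / s - s\<^sup>2 / 2" "cos \<theta>2 = h + 2 * k / s2 - s2\<^sup>2 / 2"
  shows "separation_state s2 \<theta>2 s \<theta> \<in> level_set h k"
proof -
  define b where "b = sqrt (- s * s2) / 2"
  define \<alpha> where "\<alpha> = (\<theta> + \<theta>2) / 2"
  define \<beta> where "\<beta> = (\<theta> - \<theta>2) / 2"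
  have th: "\<theta> = \<alpha> + \<beta>" "\<theta>2 = \<alpha> - \<beta>" by (auto simp: \<alpha>_def \<beta>_def field_simps)
  define d where "d = s - s2"
  have d: "d > 0" using s by (simp add: d_def)
  have "- s * s2 > 0" using s by (simp add: mult_pos_neg)
  then have b2: "4 * b\<^sup>2 = - s * s2" by (simp add: b_def power_divide)
  then have b2': "b\<^sup>2 = - (s * s2) / 4" by simp
  define p q r g1 g2 g3 where "p = - b * sin \<alpha>" and "q = b * cos \<alpha>" and "r = s + s2"
    and "g1 = (s * cos \<theta> - s2 * cos \<theta>2) / d" and "g2 = (s * sin \<theta> - s2 * sin \<theta>2) / d"
    and "g3 = - 4 * b * sin \<beta> / d"
  note defs = p_def q_def r_def g1_def g2_def g3_def
  have st: "separation_state s2 \<theta>2 s \<theta> = (p, q, r, g1, g2, g3)"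
    by (simp add: separation_state_def Let_def defs b_def \<alpha>_def \<beta>_def d_def)
  have sc: "(sin u)\<^sup>2 = 1 - (cos u)\<^sup>2" for u :: real by (simp add: sin_squared_eq)
  have pq: "p\<^sup>2 + q\<^sup>2 = b\<^sup>2" by (simp add: defs power_mult_distrib sc algebra_simps)
  have dg: "d * g1 = s * cos \<theta> - s2 * cos \<theta>2" "d * g2 = s * sin \<theta> - s2 * sin \<theta>2"
    "d * g3 = - 4 * b * sin \<beta>" using d by (auto simp: defs)
  have "d * (4 * (p * g1 + q * g2) + r * g3) = 4 * (p * (d * g1) + q * (d * g2)) + r * (d * g3)"
    by (simp add: algebra_simps)
  also have "\<dots> = 4 * b * (s + s2) * sin \<beta> * ((sin \<alpha>)\<^sup>2 + (cos \<alpha>)\<^sup>2 - 1)"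
    unfolding dg unfolding th p_def q_def r_def sin_add cos_add sin_diff cos_diff by algebra
  finally have area: "4 * (p * g1 + q * g2) + r * g3 = 0" using d by simp
  have cs: "s * cos \<theta> = h * s + 2 * k - s^3 / 2" "s2 * cos \<theta>2 = h * s2 + 2 * k - s2^3 / 2"
    using s unfolding c by (auto simp: field_simps power2_eq_square power3_eq_cube)
  have "d * g1 = d * (h - (s\<^sup>2 + s * s2 + s2\<^sup>2) / 2)"
    unfolding dg cs unfolding d_def by (simp add: field_simps power2_eq_square power3_eq_cube)
  then have g1: "g1 = h - (s\<^sup>2 + s * s2 + s2\<^sup>2) / 2" using d by simp
  have energy: "2 * (p\<^sup>2 + q\<^sup>2) + r\<^sup>2 / 2 + g1 = h"
    unfolding pq g1 using b2 by (simp add: r_def power2_eq_square field_simps)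
  have "d * (p * g3) = 2 * b\<^sup>2 * (cos \<theta>2 - cos \<theta>)"
    using dg(3) unfolding th p_def cos_add cos_diff by algebra
  also have "\<dots> = - (s * (s2 * cos \<theta>2) - s2 * (s * cos \<theta>)) / 2" using b2 by algebra
  also have "\<dots> = d * (r * b\<^sup>2 - k)"
    unfolding cs d_def r_def b2' by (simp add: field_simps power2_eq_square power3_eq_cube)
  finally have k': "r * (p\<^sup>2 + q\<^sup>2) - p * g3 = k" using d by (simp add: pq)
  have "d\<^sup>2 * (g1\<^sup>2 + g2\<^sup>2 + g3\<^sup>2) = (d * g1)\<^sup>2 + (d * g2)\<^sup>2 + (d * g3)\<^sup>2" by algebra
  also have "\<dots> = d\<^sup>2"
  proof -
    have "(sin \<alpha>)\<^sup>2 + (cos \<alpha>)\<^sup>2 = 1" "(sin \<beta>)\<^sup>2 + (cos \<beta>)\<^sup>2 = 1" by auto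
    then show ?thesis
      unfolding dg unfolding th sin_add cos_add sin_diff cos_diff d_def using b2 by algebra
  qed
  finally have "g1\<^sup>2 + g2\<^sup>2 + g3\<^sup>2 = 1" using d by simp
  with area energy k' show ?thesis by (simp add: st level_set_def)
qed

text \<open>The quadratic with roots \<open>s\<close>, \<open>s2\<close> and the two unit numbers
  determine \<theta> and \<theta>\<open>2\<close> modulo \<open>2 * pi\<close>, whereas
  \<open>separation_state\<close> uses their half sum and half difference. The state is thus
  recovered only up to the sign that \<open>mirror\<close> changes.\<close>

lemma separation_variables:
  assumes y: "y \<in> level_set h k" and k: "k \<noteq> 0"
  obtains s \<theta> s2 \<theta>2 where "s > 0" "s2 < 0"
    "cos \<theta> = h + 2 * k / s - s\<^sup>2 / 2" "cos \<theta>2 = h + 2 * k / s2 - s2\<^sup>2 / 2"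
    "y = separation_state s2 \<theta>2 s \<theta> \<or> y = mirror (separation_state s2 \<theta>2 s \<theta>)"
proof -
  obtain p q r g1 g2 g3 where y_eq: "y = (p, q, r, g1, g2, g3)" by (cases y)
  have E: "2 * (p\<^sup>2 + q\<^sup>2) + r\<^sup>2 / 2 + g1 = h" and Ar: "4 * (p * g1 + q * g2) + r * g3 = 0"
    and K: "r * (p\<^sup>2 + q\<^sup>2) - p * g3 = k" and Ge: "g1\<^sup>2 + g2\<^sup>2 + g3\<^sup>2 = 1"
    using y by (auto simp: level_set_def y_eq)
  define a where "a = p\<^sup>2 + q\<^sup>2"
  have a: "a > 0"
  proof (rule ccontr)
    assume "\<not> a > 0"
    then have "p = 0" "q = 0" using sum_power2_gt_zero_iff[of p q] by (auto simp: a_def)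
    then show False using K k by simp
  qed
  define D where "D = sqrt (r\<^sup>2 + 16 * a)"
  have D: "D > \<bar>r\<bar>" unfolding D_def using a by (intro real_less_rsqrt) auto
  have D2: "D\<^sup>2 = r\<^sup>2 + 16 * a" using a by (simp add: D_def)
  define s s2 where "s = (r + D) / 2" and "s2 = (r - D) / 2"
  have s: "s > 0" "s2 < 0" using D by (auto simp: s_def s2_def)
  have ss: "s + s2 = r" "s * s2 = - 4 * a" "s - s2 = D"
    using D2 by (auto simp: s_def s2_def field_simps power2_eq_square)
  have root: "X\<^sup>2 - r * X - 4 * a = 0" if "X = s \<or> X = s2" for X
    using that ss by (elim disjE; hypsubst) algebra+
  have angle: "\<exists>\<theta>. X * cos \<theta> = X * g1 - 2 * g3 * p \<and> X * sin \<theta> = X * g2 - 2 * g3 * q \<and>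
      cos \<theta> = h + 2 * k / X - X\<^sup>2 / 2" if X: "X = s \<or> X = s2" for X
  proof -
    have X0: "X \<noteq> 0" using X s by auto
    note R = root[OF X]
    \<comment> \<open>With the area and geometric integrals the left side equals
      \<open>X^2 - g3^2 * (X^2 - r X - 4 a)\<close>, and the bracket vanishes at a root.\<close>
    have "(X * g1 - 2 * g3 * p)\<^sup>2 + (X * g2 - 2 * g3 * q)\<^sup>2 = X\<^sup>2"
      using R Ar Ge unfolding a_def by algebra
    moreover have "g1 - 2 * g3 * p / X = (X * g1 - 2 * g3 * p) / X"
      "g2 - 2 * g3 * q / X = (X * g2 - 2 * g3 * q) / X"
      using X0 by (auto simp: field_simps)
    ultimately have "(g1 - 2 * g3 * p / X)\<^sup>2 + (g2 - 2 * g3 * q / X)\<^sup>2 = 1"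
      using X0 by (simp add: power_divide flip: add_divide_distrib)
    then obtain \<theta> where th: "g1 - 2 * g3 * p / X = cos \<theta>" "g2 - 2 * g3 * q / X = sin \<theta>"
      by (rule sincos_total_2pi)
    have 1: "X * cos \<theta> = X * g1 - 2 * g3 * p" "X * sin \<theta> = X * g2 - 2 * g3 * q"
      using X0 by (simp_all add: th[symmetric] field_simps)
    have "2 * (X * cos \<theta>) = 2 * (h * X + 2 * k) - X^3"
      using R E K unfolding 1 a_def by algebra
    then have "cos \<theta> = h + 2 * k / X - X\<^sup>2 / 2"
      using X0 by (simp add: field_simps power2_eq_square power3_eq_cube)
    with 1 show ?thesis by blast
  qed
  obtain \<theta> where t1: "s * cos \<theta> = s * g1 - 2 * g3 * p" "s * sin \<theta> = s * g2 - 2 * g3 * q"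
      "cos \<theta> = h + 2 * k / s - s\<^sup>2 / 2" using angle[of s] by auto
  obtain \<theta>2 where t2: "s2 * cos \<theta>2 = s2 * g1 - 2 * g3 * p" "s2 * sin \<theta>2 = s2 * g2 - 2 * g3 * q"
      "cos \<theta>2 = h + 2 * k / s2 - s2\<^sup>2 / 2" using angle[of s2] by auto
  obtain P Q R G1 G2 G3 where S: "separation_state s2 \<theta>2 s \<theta> = (P, Q, R, G1, G2, G3)"
    by (cases "separation_state s2 \<theta>2 s \<theta>")
  define b \<alpha> \<beta> where "b = sqrt (- s * s2) / 2" and "\<alpha> = (\<theta> + \<theta>2) / 2" and "\<beta> = (\<theta> - \<theta>2) / 2"
  have th: "\<theta> = \<alpha> + \<beta>" "\<theta>2 = \<alpha> - \<beta>" by (auto simp: \<alpha>_def \<beta>_def field_simps)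
  have b2: "b\<^sup>2 = a" using ss a by (simp add: b_def power_divide)
  have "s * cos \<theta> - s2 * cos \<theta>2 = D * g1" "s * sin \<theta> - s2 * sin \<theta>2 = D * g2"
    unfolding t1(1,2) t2(1,2) ss(3)[symmetric] by (auto simp: algebra_simps)
  then have R: "R = r" and G1: "G1 = g1" and G2: "G2 = g2"
    and PQ: "P = - b * sin \<alpha>" "Q = b * cos \<alpha>" and G3: "G3 = - 4 * b * sin \<beta> / D"
    using S D ss(1,3) by (auto simp: separation_state_def Let_def b_def \<alpha>_def \<beta>_def)
  have "separation_state s2 \<theta>2 s \<theta> \<in> level_set h k"
    using s t1(3) t2(3) by (rule separation_state_level_set)
  then have lev: "4 * (P * g1 + Q * g2) + r * G3 = 0" "g1\<^sup>2 + g2\<^sup>2 + G3\<^sup>2 = 1"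
    by (auto simp: S level_set_def R G1 G2)
  have PQ2: "P\<^sup>2 + Q\<^sup>2 = p\<^sup>2 + q\<^sup>2"
  proof -
    have "P\<^sup>2 + Q\<^sup>2 = b\<^sup>2 * ((sin \<alpha>)\<^sup>2 + (cos \<alpha>)\<^sup>2)"
      unfolding PQ by algebra
    then show ?thesis by (simp add: b2 a_def)
  qed
  have DG3: "D * G3 = - 4 * b * sin \<beta>" using D by (simp add: G3)
  have "s * s2 * (cos \<theta> - cos \<theta>2) = 2 * g3 * p * (s - s2)"
    "s * s2 * (sin \<theta> - sin \<theta>2) = 2 * g3 * q * (s - s2)" using t1 t2 by algebra+
  then have c: "- 4 * b\<^sup>2 * (cos \<theta> - cos \<theta>2) = 2 * g3 * p * D"
    "- 4 * b\<^sup>2 * (sin \<theta> - sin \<theta>2) = 2 * g3 * q * D" using ss b2 by auto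
  have "D * (G3 * P) = D * (g3 * p)" "D * (G3 * Q) = D * (g3 * q)"
    using c DG3 unfolding th cos_add cos_diff sin_add sin_diff PQ by algebra+
  then have GP: "G3 * P = g3 * p" "G3 * Q = g3 * q" using D by auto
  have "G3\<^sup>2 = g3\<^sup>2" using lev(2) Ge by simp
  then have G3': "G3 = g3 \<or> G3 = - g3" by (simp add: power2_eq_iff)
  \<comment> \<open>If \<open>g3\<close> is nonzero, its sign is the common sign, since
    \<open>G3 * P = g3 * p\<close> and \<open>G3 * Q = g3 * q\<close>. If \<open>g3 = 0\<close>
    these products carry no information; then the area integral makes both horizontal vectors
    orthogonal to the unit vector \<open>(g1, g2)\<close>, and equal lengths leave just a
    sign.\<close>
  have "(P, Q, G3) = (p, q, g3) \<or> (P, Q, G3) = (- p, - q, - g3)"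
  proof (cases "g3 = 0")
    case False
    have "g3 * P = g3 * p \<and> g3 * Q = g3 * q \<and> G3 = g3 \<or>
        g3 * P = g3 * (- p) \<and> g3 * Q = g3 * (- q) \<and> G3 = - g3"
      using G3' GP by auto
    then show ?thesis using False unfolding mult_cancel_left by auto
  next
    case True
    then have G30: "G3 = 0" using G3' by auto
    have o: "p * g1 + q * g2 = 0" "P * g1 + Q * g2 = 0" "g1\<^sup>2 + g2\<^sup>2 = 1"
      using Ar lev Ge True G30 by auto
    define e f where "e = q * g1 - p * g2" and "f = Q * g1 - P * g2"
    have pe: "p = - e * g2" "q = e * g1" using o unfolding e_def by algebra+
    have pf: "P = - f * g2" "Q = f * g1" using o unfolding f_def by algebra+
    have "f\<^sup>2 = e\<^sup>2" using PQ2 o(3) unfolding pe pf by algebra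
    then have "f = e \<or> f = - e" by (simp add: power2_eq_iff)
    then show ?thesis using pe pf True G30 by auto
  qed
  then have "y = separation_state s2 \<theta>2 s \<theta> \<or> y = mirror (separation_state s2 \<theta>2 s \<theta>)"
    unfolding S y_eq R G1 G2 by auto
  then show ?thesis by (rule that[OF s t1(3) t2(3)])
qed

text \<open>With \<open>s2\<close> and \<theta>\<open>2\<close> frozen and
  \<open>s = G (cos u)\<close>, the curve \<open>M\<close> stays on the level set for all real
  \<open>u\<close>. A full turn of \<open>u\<close> brings \<open>s\<close> back but lands on the
  mirror image.\<close>

lemma connected_component_mirror_pos:
  assumes y: "y \<in> level_set h k" and k: "k > 0"
  shows "connected_component (level_set h k) y (mirror y)"
proof -
  obtain s \<theta> s2 \<theta>2 where s: "s > 0" "s2 < 0"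
    and c: "cos \<theta> = h + 2 * k / s - s\<^sup>2 / 2" "cos \<theta>2 = h + 2 * k / s2 - s2\<^sup>2 / 2"
    and y_eq: "y = separation_state s2 \<theta>2 s \<theta> \<or> y = mirror (separation_state s2 \<theta>2 s \<theta>)"
    by (rule separation_variables[OF y]) (use k in auto)
  obtain G where G: "continuous_on {-1..1} G" "\<And>c. c \<in> {-1..1} \<Longrightarrow> G c > 0"
    "\<And>c. c \<in> {-1..1} \<Longrightarrow> h + 2 * k / G c - (G c)\<^sup>2 / 2 = c"
    "\<And>s. s > 0 \<Longrightarrow> h + 2 * k / s - s\<^sup>2 / 2 \<in> {-1..1} \<Longrightarrow> G (h + 2 * k / s - s\<^sup>2 / 2) = s"
    by (rule separation_function_inverse[OF k, of h], rule that)
  define M where "M = (\<lambda>u. separation_state s2 \<theta>2 (G (cos u)) u)"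
  have Gs: "G (cos \<theta>) = s" using G(4)[of s] s c(1) by (metis atLeastAtMost_iff cos_ge_minus_one cos_le_one)
  have Gpos: "G (cos u) > 0" for u by (rule G(2)) simp
  have ne: "G (cos u) - s2 \<noteq> 0" for u using Gpos[of u] s by linarith
  have Gc: "continuous_on UNIV (\<lambda>u. G (cos u))"
    by (rule continuous_on_compose2[OF G(1)]) (auto intro: continuous_intros)
  have "continuous_on UNIV M"
    unfolding M_def separation_state_def Let_def
    by (intro continuous_intros Gc) (use ne in auto)
  then have con: "connected (range M)" by (rule connected_continuous_image) simp
  have sub: "range M \<subseteq> level_set h k"
    unfolding M_def using G(3)[of "cos u" for u] s c(2) Gpos
    by (auto intro!: separation_state_level_set)
  have M1: "M \<theta> = separation_state s2 \<theta>2 s \<theta>" by (simp add: M_def Gs)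
  have M2: "M (\<theta> + 2 * pi) = mirror (M \<theta>)"
    by (simp add: M_def separation_state_add_2pi)
  have "{y, mirror y} \<subseteq> range M"
    using y_eq M1 M2 by (metis insert_subset empty_subsetI mirror_mirror rangeI)
  then show ?thesis using con sub by (auto simp: connected_component_def)
qed

text \<open>Reverses the sign of \<open>k\<close> and keeps the other integrals, so that negative
  \<open>k\<close> reduces to positive \<open>k\<close>, where the positive root is the monotone
  one.\<close>

fun reflect :: "state \<Rightarrow> state" where
  "reflect (p, q, r, g1, g2, g3) = (p, q, - r, g1, g2, - g3)"

lemma mirror_reflect: "mirror (reflect y) = reflect (mirror y)"
  by (cases y) simp

lemma reflect_reflect [simp]: "reflect (reflect y) = y"
  by (cases y) simp

lemma level_set_reflect: "reflect y \<in> level_set h (- k) \<longleftrightarrow> y \<in> level_set h k"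
  by (cases y) (auto simp: level_set_def)

lemma continuous_on_reflect: "continuous_on A reflect"
proof -
  have eq: "reflect = (\<lambda>(p, q, r, g1, g2, g3). (p, q, - r, g1, g2, - g3))" by auto
  show ?thesis unfolding eq split_beta by (intro continuous_intros)
qed

lemma connected_component_mirror:
  assumes y: "y \<in> level_set h k" and k: "k \<noteq> 0"
  shows "connected_component (level_set h k) y (mirror y)"
proof (cases "k > 0")
  case True
  with y show ?thesis by (rule connected_component_mirror_pos)
next
  case False
  have "connected_component (level_set h (- k)) (reflect y) (mirror (reflect y))"
    using y k False by (intro connected_component_mirror_pos) (auto simp: level_set_reflect)
  then obtain C where C: "connected C" "C \<subseteq> level_set h (- k)" "reflect y \<in> C" "mirror (reflect y) \<in> C"
    by (auto simp: connected_component_def)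
  have "connected (reflect ` C)" using C(1) continuous_on_reflect by (rule connected_continuous_image[rotated])
  moreover have "reflect ` C \<subseteq> level_set h k"
    using C(2) level_set_reflect[of _ h "- k"] by auto
  moreover have "y \<in> reflect ` C" "mirror y \<in> reflect ` C"
    using C(3,4) by (metis image_eqI reflect_reflect, metis image_eqI mirror_reflect reflect_reflect)
  ultimately show ?thesis by (auto simp: connected_component_def)
qed

subsection \<open>Solutions on a level set\<close>

lemma has_vector_derivative_Pair_iff:
  "((\<lambda>t. (f t, g t)) has_vector_derivative (a, b)) (at x within S) \<longleftrightarrow>
   (f has_vector_derivative a) (at x within S) \<and> (g has_vector_derivative b) (at x within S)"
  using bounded_linear.has_vector_derivative[OF bounded_linear_fst, of "\<lambda>t. (f t, g t)" "(a, b)"]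
    bounded_linear.has_vector_derivative[OF bounded_linear_snd, of "\<lambda>t. (f t, g t)" "(a, b)"]
  by (auto intro: has_vector_derivative_Pair)

lemma gc_solution_components:
  "gc_solution (\<lambda>t. (p t, q t, r t, g1 t, g2 t, g3 t)) \<longleftrightarrow>
    (\<forall>t. (p has_real_derivative 3 * q t * r t / 4) (at t) \<and>
         (q has_real_derivative (g3 t - 3 * r t * p t) / 4) (at t) \<and>
         (r has_real_derivative - g2 t) (at t) \<and>
         (g1 has_real_derivative r t * g2 t - q t * g3 t) (at t) \<and>
         (g2 has_real_derivative p t * g3 t - r t * g1 t) (at t) \<and>
         (g3 has_real_derivative q t * g1 t - p t * g2 t) (at t))"
  by (simp add: gc_solution_def has_vector_derivative_Pair_iff has_real_derivative_iff_has_vector_derivative)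

lemma state_components:
  fixes x :: "real \<Rightarrow> state"
  obtains p q r g1 g2 g3 where "x = (\<lambda>t. (p t, q t, r t, g1 t, g2 t, g3 t))"
proof
  show "x = (\<lambda>t. (fst (x t), fst (snd (x t)), fst (snd (snd (x t))), fst (snd (snd (snd (x t)))),
      fst (snd (snd (snd (snd (x t))))), snd (snd (snd (snd (snd (x t)))))))"
    by simp
qed

lemma gc_solution_mirror:
  assumes "gc_solution x"
  shows "gc_solution (\<lambda>t. mirror (x t))"
proof -
  obtain p q r g1 g2 g3 where x: "x = (\<lambda>t. (p t, q t, r t, g1 t, g2 t, g3 t))"
    by (rule state_components)
  have "gc_solution (\<lambda>t. (- p t, - q t, r t, g1 t, g2 t, - g3 t))"
    using assms unfolding x gc_solution_components
    by (auto intro!: derivative_eq_intros simp: field_simps)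
  then show ?thesis by (simp add: x)
qed

lemma gc_solution_shift:
  assumes "gc_solution x"
  shows "gc_solution (\<lambda>t. x (s + t))"
  unfolding gc_solution_def
proof
  fix t
  have "(x has_vector_derivative gc_field (x (s + t))) (at (s + t))"
    using assms by (simp add: gc_solution_def)
  then have "(x \<circ> (+) s has_vector_derivative 1 *\<^sub>R gc_field (x (s + t))) (at t)"
    by (intro vector_diff_chain_at) (auto intro!: derivative_eq_intros)
  then show "((\<lambda>t. x (s + t)) has_vector_derivative gc_field (x (s + t))) (at t)"
    by (simp add: o_def)
qed

text \<open>The squared distance is differentiable even where the solutions meet, and its derivative
  is at most \<open>2 L\<close> times itself in absolute value. Multiplying by the matching
  exponential gives a monotone function in either direction of time.\<close>

lemma gronwall_dist:
  fixes x y :: "real \<Rightarrow> 'a :: real_inner"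
  assumes x: "\<And>t. (x has_vector_derivative F (x t)) (at t)"
    and y: "\<And>t. (y has_vector_derivative F (y t)) (at t)"
    and L: "\<And>t. norm (F (x t) - F (y t)) \<le> L * norm (x t - y t)"
  shows "norm (x t - y t) \<le> exp (L * \<bar>t\<bar>) * norm (x 0 - y 0)"
proof -
  define u where "u = (\<lambda>t. x t - y t)"
  define u' where "u' = (\<lambda>t. F (x t) - F (y t))"
  define V where "V = (\<lambda>t. u t \<bullet> u t)"
  have du: "(u has_vector_derivative u' t) (at t)" for t
    unfolding u_def u'_def by (intro derivative_intros x y)
  have dV: "(V has_real_derivative 2 * (u t \<bullet> u' t)) (at t)" for t
    using bounded_bilinear.has_vector_derivative[OF bounded_bilinear_inner du du, of t]
    by (simp add: V_def has_real_derivative_iff_has_vector_derivative inner_commute)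
  have "\<bar>u t \<bullet> u' t\<bar> \<le> L * V t" for t
  proof -
    have "\<bar>u t \<bullet> u' t\<bar> \<le> norm (u t) * norm (u' t)" by (rule Cauchy_Schwarz_ineq2)
    also have "\<dots> \<le> norm (u t) * (L * norm (u t))"
      using L[of t] by (intro mult_left_mono) (auto simp: u_def u'_def)
    finally show ?thesis by (simp add: V_def dot_square_norm power2_eq_square mult_ac)
  qed
  then have bd: "u t \<bullet> u' t \<le> L * V t" "- (L * V t) \<le> u t \<bullet> u' t" for t
    by (metis abs_le_D1, metis abs_le_D2 minus_le_iff)
  have "V t \<le> exp (2 * L * \<bar>t\<bar>) * V 0"
  proof (cases "t \<ge> 0")
    case True
    have "V t * exp (- 2 * L * t) \<le> V 0 * exp (- 2 * L * 0)"
    proof (rule DERIV_nonpos_imp_nonincreasing[OF True], intro exI conjI)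
      fix s
      show "((\<lambda>s. V s * exp (- 2 * L * s)) has_real_derivative
          (2 * (u s \<bullet> u' s) - 2 * L * V s) * exp (- 2 * L * s)) (at s)"
        by (rule derivative_eq_intros dV refl)+ (simp add: algebra_simps)
      show "(2 * (u s \<bullet> u' s) - 2 * L * V s) * exp (- 2 * L * s) \<le> 0"
        using bd[of s] by (intro mult_nonpos_nonneg) auto
    qed
    then show ?thesis using True by (simp add: exp_minus field_simps)
  next
    case False
    then have neg: "t \<le> 0" by simp
    have "V t * exp (2 * L * t) \<le> V 0 * exp (2 * L * 0)"
    proof (rule DERIV_nonneg_imp_nondecreasing[OF neg], intro exI conjI)
      fix s
      show "((\<lambda>s. V s * exp (2 * L * s)) has_real_derivative
          (2 * (u s \<bullet> u' s) + 2 * L * V s) * exp (2 * L * s)) (at s)"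
        by (rule derivative_eq_intros dV refl)+ (simp add: algebra_simps)
      show "0 \<le> (2 * (u s \<bullet> u' s) + 2 * L * V s) * exp (2 * L * s)"
        using bd[of s] by (intro mult_nonneg_nonneg) auto
    qed
    then show ?thesis using False by (simp add: exp_minus field_simps)
  qed
  then have "(norm (u t))\<^sup>2 \<le> (exp (L * \<bar>t\<bar>) * norm (u 0))\<^sup>2"
    by (simp add: V_def dot_square_norm power_mult_distrib flip: exp_double) (simp add: mult_ac)
  then show ?thesis unfolding u_def by (rule power2_le_imp_le) simp
qed

lemma norm_state_bounds:
  fixes p q r g1 g2 g3 :: real
  defines "N \<equiv> norm (p, q, r, g1, g2, g3)"
  shows "\<bar>p\<bar> \<le> N" "\<bar>q\<bar> \<le> N" "\<bar>r\<bar> \<le> N" "\<bar>g1\<bar> \<le> N" "\<bar>g2\<bar> \<le> N" "\<bar>g3\<bar> \<le> N"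
    and "N \<le> \<bar>p\<bar> + \<bar>q\<bar> + \<bar>r\<bar> + \<bar>g1\<bar> + \<bar>g2\<bar> + \<bar>g3\<bar>"
proof -
  have N: "N = sqrt (p\<^sup>2 + q\<^sup>2 + r\<^sup>2 + g1\<^sup>2 + g2\<^sup>2 + g3\<^sup>2)"
    by (simp add: N_def norm_Pair add_ac)
  show "\<bar>p\<bar> \<le> N" "\<bar>q\<bar> \<le> N" "\<bar>r\<bar> \<le> N" "\<bar>g1\<bar> \<le> N" "\<bar>g2\<bar> \<le> N" "\<bar>g3\<bar> \<le> N"
    unfolding N by (rule real_le_rsqrt, simp)+
  have "norm (g2, g3) \<le> \<bar>g2\<bar> + \<bar>g3\<bar>" using norm_Pair_le[of g2 g3] by simp
  moreover have "norm (g1, g2, g3) \<le> \<bar>g1\<bar> + norm (g2, g3)" using norm_Pair_le[of g1] by simp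
  moreover have "norm (r, g1, g2, g3) \<le> \<bar>r\<bar> + norm (g1, g2, g3)" using norm_Pair_le[of r] by simp
  moreover have "norm (q, r, g1, g2, g3) \<le> \<bar>q\<bar> + norm (r, g1, g2, g3)" using norm_Pair_le[of q] by simp
  moreover have "N \<le> \<bar>p\<bar> + norm (q, r, g1, g2, g3)"
    unfolding N_def using norm_Pair_le[of p] by simp
  ultimately show "N \<le> \<bar>p\<bar> + \<bar>q\<bar> + \<bar>r\<bar> + \<bar>g1\<bar> + \<bar>g2\<bar> + \<bar>g3\<bar>" by linarith
qed

lemma gc_field_lipschitz:
  assumes "norm y \<le> R" "norm z \<le> R"
  shows "norm (gc_field y - gc_field z) \<le> (16 * R + 2) * norm (y - z)"
proof -
  obtain p q r g1 g2 g3 where y: "y = (p, q, r, g1, g2, g3)" by (cases y)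
  obtain p' q' r' g1' g2' g3' where z: "z = (p', q', r', g1', g2', g3')" by (cases z)
  define d where "d = norm (y - z)"
  have d0: "d \<ge> 0" by (simp add: d_def)
  note bdy = norm_state_bounds[where p = p and q = q and r = r and ?g1.0 = g1 and ?g2.0 = g2 and ?g3.0 = g3, folded y]
    and bz = norm_state_bounds[where p = p' and q = q' and r = r' and ?g1.0 = g1' and ?g2.0 = g2' and ?g3.0 = g3', folded z]
  have yz: "y - z = (p - p', q - q', r - r', g1 - g1', g2 - g2', g3 - g3')" by (simp add: y z)
  note bd = norm_state_bounds[where p = "p - p'" and q = "q - q'" and r = "r - r'" and ?g1.0 = "g1 - g1'" and ?g2.0 = "g2 - g2'" and ?g3.0 = "g3 - g3'",
      folded yz, folded d_def]
  have m: "\<bar>a * b - a' * b'\<bar> \<le> 2 * (R * d)"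
    if "\<bar>a\<bar> \<le> norm y" "\<bar>b'\<bar> \<le> norm z" "\<bar>a - a'\<bar> \<le> d" "\<bar>b - b'\<bar> \<le> d" for a b a' b' :: real
  proof -
    have "a * b - a' * b' = a * (b - b') + b' * (a - a')" by algebra
    also have "\<bar>\<dots>\<bar> \<le> \<bar>a\<bar> * \<bar>b - b'\<bar> + \<bar>b'\<bar> * \<bar>a - a'\<bar>"
      by (rule order_trans[OF abs_triangle_ineq]) (simp add: abs_mult)
    also have "\<dots> \<le> R * d + R * d"
      using that assms by (intro add_mono mult_mono) auto
    finally show ?thesis by simp
  qed
  have "\<bar>3 * q * r / 4 - 3 * q' * r' / 4\<bar> \<le> 3 / 2 * (R * d)"
    using m[of q r' q' r, OF bdy(2) bz(3) bd(2,3)] by linarith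
  moreover have "\<bar>(g3 - 3 * r * p) / 4 - (g3' - 3 * r' * p') / 4\<bar> \<le> d + 3 / 2 * (R * d)"
  proof -
    have eq: "(g3 - 3 * r * p) / 4 - (g3' - 3 * r' * p') / 4 = (g3 - g3') / 4 - 3 / 4 * (r * p - r' * p')"
      by (simp add: field_simps)
    have bound: "\<bar>u / 4 - 3 / 4 * v\<bar> \<le> d + 3 / 2 * (R * d)"
      if "\<bar>u\<bar> \<le> d" "\<bar>v\<bar> \<le> 2 * (R * d)" for u v
      using that d0 by linarith
    show ?thesis
      unfolding eq using m[of r p' r' p, OF bdy(3) bz(1) bd(3,1)] bd(6) by (intro bound)
  qed
  moreover have "\<bar>- g2 - - g2'\<bar> \<le> d" using bd(5) by linarith
  moreover have "\<bar>r * g2 - q * g3 - (r' * g2' - q' * g3')\<bar> \<le> 4 * (R * d)"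
    using m[of r g2' r' g2, OF bdy(3) bz(5) bd(3,5)] m[of q g3' q' g3, OF bdy(2) bz(6) bd(2,6)]
    by linarith
  moreover have "\<bar>p * g3 - r * g1 - (p' * g3' - r' * g1')\<bar> \<le> 4 * (R * d)"
    using m[of p g3' p' g3, OF bdy(1) bz(6) bd(1,6)] m[of r g1' r' g1, OF bdy(3) bz(4) bd(3,4)]
    by linarith
  moreover have "\<bar>q * g1 - p * g2 - (q' * g1' - p' * g2')\<bar> \<le> 4 * (R * d)"
    using m[of q g1' q' g1, OF bdy(2) bz(4) bd(2,4)] m[of p g2' p' g2, OF bdy(1) bz(5) bd(1,5)]
    by linarith
  \<comment> \<open>Each product of two coordinates contributes at most \<open>2 * (R * d)\<close>.
    The six components sum to \<open>3/2 + 3/2 + 4 + 4 + 4 = 15\<close> multiples of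
    \<open>R * d\<close>, and the linear terms account for \<open>2 * d\<close>.\<close>
  ultimately have "norm (gc_field y - gc_field z) \<le> 15 * (R * d) + 2 * d"
    unfolding y z gc_field.simps diff_Pair
    by (intro order_trans[OF norm_state_bounds(7)]) linarith
  also have "\<dots> \<le> (16 * R + 2) * d"
    using d0 order_trans[OF norm_ge_zero assms(1)] by (simp add: algebra_simps)
  finally show ?thesis by (simp add: d_def)
qed

lemma level_set_bounds:
  assumes "(p, q, r, g1, g2, g3) \<in> level_set h k"
  shows "\<bar>p\<bar> \<le> \<bar>h\<bar> + 2" "\<bar>q\<bar> \<le> \<bar>h\<bar> + 2" "\<bar>r\<bar> \<le> \<bar>h\<bar> + 2" "\<bar>g1\<bar> \<le> 1" "\<bar>g2\<bar> \<le> 1" "\<bar>g3\<bar> \<le> 1"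
proof -
  have E: "2 * (p\<^sup>2 + q\<^sup>2) + r\<^sup>2 / 2 + g1 = h" and G: "g1\<^sup>2 + g2\<^sup>2 + g3\<^sup>2 = 1"
    using assms by (auto simp: level_set_def)
  have "g1\<^sup>2 \<le> 1" "g2\<^sup>2 \<le> 1" "g3\<^sup>2 \<le> 1"
    using G zero_le_power2[of g1] zero_le_power2[of g2] zero_le_power2[of g3] by linarith+
  then show g: "\<bar>g1\<bar> \<le> 1" "\<bar>g2\<bar> \<le> 1" "\<bar>g3\<bar> \<le> 1" by (simp_all add: abs_square_le_1)
  \<comment> \<open>The energy bounds \<open>r^2\<close> by \<open>2 * \<bar>h\<bar> + 2\<close>,
    and likewise, with room to spare, \<open>p^2\<close> and \<open>q^2\<close>; \<open>W\<close> is
    a perfect square above this.\<close>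
  define W where "W = (\<bar>h\<bar> + 2)\<^sup>2"
  have "2 * \<bar>h\<bar> + 2 \<le> W" by (simp add: W_def power2_eq_square algebra_simps)
  moreover have "2 * p\<^sup>2 + 2 * q\<^sup>2 + r\<^sup>2 / 2 \<le> \<bar>h\<bar> + 1" using E g(1) by argo
  ultimately have "p\<^sup>2 \<le> W" "q\<^sup>2 \<le> W" "r\<^sup>2 \<le> W"
    using zero_le_power2[of p] zero_le_power2[of q] zero_le_power2[of r] abs_ge_zero[of h]
    by linarith+
  then show "\<bar>p\<bar> \<le> \<bar>h\<bar> + 2" "\<bar>q\<bar> \<le> \<bar>h\<bar> + 2" "\<bar>r\<bar> \<le> \<bar>h\<bar> + 2"
    by (simp_all add: W_def abs_le_square_iff[symmetric])
qed

lemma norm_level_set: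
  assumes "y \<in> level_set h k"
  shows "norm y \<le> 3 * \<bar>h\<bar> + 9"
proof -
  obtain p q r g1 g2 g3 where y: "y = (p, q, r, g1, g2, g3)" by (cases y)
  show ?thesis
    using level_set_bounds[OF assms[unfolded y]] norm_state_bounds(7)[of p q r g1 g2 g3]
    unfolding y by linarith
qed

lemma compact_level_set: "compact (level_set h k)"
proof -
  have eq: "level_set h k = {y. case y of (p, q, r, g1, g2, g3) \<Rightarrow>
      2 * (p\<^sup>2 + q\<^sup>2) + r\<^sup>2 / 2 + g1 = h \<and> 4 * (p * g1 + q * g2) + r * g3 = 0 \<and>
      r * (p\<^sup>2 + q\<^sup>2) - p * g3 = k \<and> g1\<^sup>2 + g2\<^sup>2 + g3\<^sup>2 = 1}"
    by (auto simp: level_set_def)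
  have "closed (level_set h k)"
    unfolding eq split_beta
    by (intro closed_Collect_conj closed_Collect_eq continuous_intros) auto
  moreover have "bounded (level_set h k)"
    unfolding bounded_iff using norm_level_set by blast
  ultimately show ?thesis by (simp add: compact_eq_bounded_closed)
qed

text \<open>The level set lies in a ball, so one Lipschitz constant serves all its solutions at all
  times. The explicit rate is used again to follow the orbit of a pole over a given time.\<close>

lemma gc_solution_dist:
  assumes "gc_solution x" "gc_solution y" "\<And>t. x t \<in> level_set h k" "\<And>t. y t \<in> level_set h k"
  shows "dist (x t) (y t) \<le> exp ((16 * (3 * \<bar>h\<bar> + 9) + 2) * \<bar>t\<bar>) * dist (x 0) (y 0)"
  unfolding dist_norm
proof (rule gronwall_dist)
  show "norm (gc_field (x s) - gc_field (y s)) \<le> (16 * (3 * \<bar>h\<bar> + 9) + 2) * norm (x s - y s)" for s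
    by (intro gc_field_lipschitz norm_level_set[OF assms(3)] norm_level_set[OF assms(4)])
qed (use assms in \<open>auto simp: gc_solution_def\<close>)

lemma gc_solution_unique:
  assumes "gc_solution x" "gc_solution y" "\<And>t. x t \<in> level_set h k" "\<And>t. y t \<in> level_set h k"
    and "x 0 = y 0"
  shows "x t = y t"
  using gc_solution_dist[OF assms(1-4), of t] assms(5) by simp

subsection \<open>Precession near the poles\<close>

text \<open>As \<open>(p, q)\<close> tends to zero, \<open>r * (p^2 + q^2) - p * g3\<close> tends to
  zero at least linearly in its length \<open>w\<close>, because \<open>r\<close> and
  \<open>g3\<close> are bounded. A nonzero value \<open>k\<close> thus keeps \<open>w\<close> away
  from zero. The bound permits division by \<open>p^2 + q^2\<close> later on.\<close>

lemma level_set_horizontal_lower: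
  assumes "k \<noteq> 0"
  obtains a0 where "a0 > 0"
    "\<And>p q r g1 g2 g3. (p, q, r, g1, g2, g3) \<in> level_set h k \<Longrightarrow> a0 \<le> p\<^sup>2 + q\<^sup>2"
proof
  define R where "R = \<bar>h\<bar> + 2"
  define a0 where "a0 = min 1 ((k / (R + 1))\<^sup>2)"
  have R: "R > 0" by (simp add: R_def)
  then show "a0 > 0" using assms by (simp add: a0_def)
  show "a0 \<le> p\<^sup>2 + q\<^sup>2" if lev: "(p, q, r, g1, g2, g3) \<in> level_set h k" for p q r g1 g2 g3
  proof (cases "p\<^sup>2 + q\<^sup>2 \<ge> 1")
    case True
    then show ?thesis by (simp add: a0_def)
  next
    case False
    define w where "w = sqrt (p\<^sup>2 + q\<^sup>2)"
    have w: "0 \<le> w" "w \<le> 1" "w\<^sup>2 = p\<^sup>2 + q\<^sup>2" "\<bar>p\<bar> \<le> w"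
      using False by (auto simp: w_def intro: real_le_rsqrt)
    have "k = r * w\<^sup>2 - p * g3" using lev w by (simp add: level_set_def)
    also have "\<bar>\<dots>\<bar> \<le> \<bar>r\<bar> * w\<^sup>2 + \<bar>p\<bar> * \<bar>g3\<bar>"
      by (rule order_trans[OF abs_triangle_ineq4]) (simp add: abs_mult)
    also have "w\<^sup>2 \<le> w" using w(1,2) by (simp add: power2_eq_square mult_left_le)
    then have "\<bar>r\<bar> * w\<^sup>2 + \<bar>p\<bar> * \<bar>g3\<bar> \<le> R * w + w * 1"
      using level_set_bounds[OF lev] w(1,4) by (intro add_mono mult_mono) (auto simp: R_def)
    also have "\<dots> = (R + 1) * w" by (simp add: algebra_simps)
    finally have "\<bar>k\<bar> / (R + 1) \<le> w" using R by (simp add: field_simps)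
    then have "(\<bar>k\<bar> / (R + 1))\<^sup>2 \<le> w\<^sup>2" using R by (intro power_mono) auto
    then show ?thesis using w by (simp add: a0_def power_divide)
  qed
qed

lemma continuous_nonzero_sign:
  fixes f :: "real \<Rightarrow> real"
  assumes "continuous_on {a..b} f" "\<And>t. t \<in> {a..b} \<Longrightarrow> f t \<noteq> 0"
  shows "\<exists>\<sigma> :: real. (\<sigma> = 1 \<or> \<sigma> = -1) \<and> (\<forall>t\<in>{a..b}. \<sigma> * f t > 0)"
proof -
  have conn: "connected (f ` {a..b})" using assms(1) by (intro connected_continuous_image) auto
  have "(\<forall>t\<in>{a..b}. f t > 0) \<or> (\<forall>t\<in>{a..b}. f t < 0)"
  proof (rule ccontr)
    assume "\<not> ?thesis"
    then obtain s t where st: "s \<in> {a..b}" "t \<in> {a..b}" "f s \<le> 0" "f t \<ge> 0"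
      by (meson linorder_not_less)
    then have "0 \<in> f ` {a..b}" using conn connectedD_interval[of "f ` {a..b}" "f s" "f t" 0] by auto
    then show False using assms(2) by auto
  qed
  then show ?thesis
  proof
    assume "\<forall>t\<in>{a..b}. f t > 0"
    then show ?thesis by (intro exI[of _ 1]) auto
  next
    assume "\<forall>t\<in>{a..b}. f t < 0"
    then show ?thesis by (intro exI[of _ "-1"]) auto
  qed
qed

locale gc_motion =
  fixes x :: "real \<Rightarrow> state" and h k :: real and p q r g1 g2 g3 :: "real \<Rightarrow> real"
  assumes sol: "gc_solution x" and lev: "\<And>t. x t \<in> level_set h k" and k: "k \<noteq> 0"
    and x_eq: "x = (\<lambda>t. (p t, q t, r t, g1 t, g2 t, g3 t))"
begin

lemma derivs:
  "(p has_real_derivative 3 * q t * r t / 4) (at t)"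
  "(q has_real_derivative (g3 t - 3 * r t * p t) / 4) (at t)"
  "(r has_real_derivative - g2 t) (at t)"
  "(g1 has_real_derivative r t * g2 t - q t * g3 t) (at t)"
  "(g2 has_real_derivative p t * g3 t - r t * g1 t) (at t)"
  "(g3 has_real_derivative q t * g1 t - p t * g2 t) (at t)"
  using sol unfolding x_eq gc_solution_components by auto

lemmas conts = derivs[THEN DERIV_isCont]

lemma lev_eqs:
  "4 * (p t * g1 t + q t * g2 t) + r t * g3 t = 0" "(g1 t)\<^sup>2 + (g2 t)\<^sup>2 + (g3 t)\<^sup>2 = 1"
  using lev[of t] by (auto simp: level_set_def x_eq)

lemma bounds:
  "\<bar>p t\<bar> \<le> \<bar>h\<bar> + 2" "\<bar>q t\<bar> \<le> \<bar>h\<bar> + 2" "\<bar>r t\<bar> \<le> \<bar>h\<bar> + 2" "\<bar>g1 t\<bar> \<le> 1" "\<bar>g2 t\<bar> \<le> 1" "\<bar>g3 t\<bar> \<le> 1"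
  using level_set_bounds[of "p t" "q t" "r t" "g1 t" "g2 t" "g3 t" h k] lev[of t] by (auto simp: x_eq)

text \<open>In terms of the horizontal vectors \<open>(p, q)\<close> and \<open>(g1, g2)\<close>:
  \<open>a\<close> and \<open>Y\<close> are their squared lengths, \<open>n\<close> is their scalar
  product and \<open>m\<close> their cross product. The precession rate is \<open>n / Y\<close>, the
  poles are the zeros of \<open>Y\<close>, and Lagrange's identity reads
  \<open>n^2 + m^2 = a Y\<close>.\<close>

definition "a t = (p t)\<^sup>2 + (q t)\<^sup>2"
definition "Y t = (g1 t)\<^sup>2 + (g2 t)\<^sup>2"
definition "n t = p t * g1 t + q t * g2 t"
definition "m t = p t * g2 t - q t * g1 t"

lemma a_pos: "a t > 0"
proof -
  obtain a0 where "a0 > 0" "\<And>p q r g1 g2 g3. (p, q, r, g1, g2, g3) \<in> level_set h k \<Longrightarrow> a0 \<le> p\<^sup>2 + q\<^sup>2"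
    by (rule level_set_horizontal_lower[OF k, of h], rule that)
  from this(1) this(2)[of "p t" "q t" "r t" "g1 t" "g2 t" "g3 t"] show ?thesis
    using lev[of t] by (simp add: x_eq a_def)
qed

lemma Y_nonneg: "Y t \<ge> 0" by (simp add: Y_def)

lemma Y_eq: "Y t = 1 - (g3 t)\<^sup>2" using lev_eqs(2)[of t] by (simp add: Y_def)

lemma n_eq: "n t = - (r t * g3 t) / 4" using lev_eqs(1)[of t] by (simp add: n_def)

lemma nm: "(n t)\<^sup>2 + (m t)\<^sup>2 = a t * Y t"
  unfolding n_def m_def a_def Y_def by algebra

lemma dY: "(Y has_real_derivative 2 * g3 t * m t) (at t)"
  unfolding Y_def[abs_def] m_def
  by (rule derivative_eq_intros derivs refl)+ (simp add: algebra_simps)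

lemma dn: "(n has_real_derivative (g2 t * g3 t + r t * m t) / 4) (at t)"
  unfolding n_eq[abs_def] m_def
  by (auto intro!: derivative_eq_intros derivs simp: field_simps)

lemma dm: "(m has_real_derivative a t * g3 t - (r t * n t + g3 t * g1 t) / 4) (at t)"
  unfolding m_def[abs_def] n_def a_def
  by (rule derivative_eq_intros derivs refl)+ (simp add: field_simps power2_eq_square)

lemmas conts' = dY[THEN DERIV_isCont] dn[THEN DERIV_isCont] dm[THEN DERIV_isCont]

lemma gamma3_pole: "gamma3 (x t) = 1 \<or> gamma3 (x t) = -1 \<longleftrightarrow> Y t = 0"
proof -
  have "Y t = 0 \<longleftrightarrow> (g3 t)\<^sup>2 = 1" unfolding Y_eq by auto
  then show ?thesis by (simp add: x_eq power2_eq_1_iff)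
qed

lemma node_rate_eq: "node_rate (x t) = n t / Y t"
  by (simp add: x_eq n_def Y_def)

lemma precession_rate_regular: "Y t \<noteq> 0 \<Longrightarrow> precession_rate x t = n t / Y t"
  unfolding precession_rate_def gamma3_pole node_rate_eq by simp

lemma node_rate_limit:
  assumes Y0: "Y t = 0"
  shows "eventually (\<lambda>s. Y s \<noteq> 0) (at t)"
    and "((\<lambda>s. n s / Y s) \<longlongrightarrow> p t / (8 * a t)) (at t)"
proof -
  have g: "g1 t = 0" "g2 t = 0" using Y0 unfolding Y_def by (auto simp: sum_power2_eq_zero_iff)
  have g3: "(g3 t)\<^sup>2 = 1" using Y0 by (simp add: Y_eq)
  then have g30: "g3 t \<noteq> 0" by auto
  have nm0: "n t = 0" "m t = 0" by (auto simp: n_def m_def g)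
  have r0: "r t = 0" using nm0(1) g30 by (simp add: n_eq)
  have at: "a t \<noteq> 0" using a_pos[of t] by simp
  \<comment> \<open>At a pole \<open>m\<close> has a simple zero, its derivative being
    \<open>a * g3\<close>. By Lagrange's identity poles are therefore isolated in time. Since
    \<open>n\<close> is a multiple of \<open>r * g3\<close>, l'Hopital is needed only for
    \<open>r / Y\<close>, where the derivatives again form a quotient of two simple expressions
    vanishing at the pole.\<close>
  have lm: "((\<lambda>s. m s / (s - t)) \<longlongrightarrow> a t * g3 t) (at t)"
    using dm[of t] unfolding has_field_derivative_iff by (simp add: nm0 g)
  have lg: "((\<lambda>s. g2 s / (s - t)) \<longlongrightarrow> p t * g3 t) (at t)"
    using derivs(5)[of t] unfolding has_field_derivative_iff by (simp add: g)
  have "eventually (\<lambda>s. m s / (s - t) \<noteq> 0) (at t)"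
    by (rule tendsto_imp_eventually_ne[OF lm]) (use at g30 in simp)
  then have em: "eventually (\<lambda>s. m s \<noteq> 0) (at t)" by eventually_elim auto
  then show eY: "eventually (\<lambda>s. Y s \<noteq> 0) (at t)"
  proof eventually_elim
    case (elim s)
    then show ?case using nm[of s] by (auto simp: sum_power2_eq_zero_iff)
  qed
  have lg3: "(g3 \<longlongrightarrow> g3 t) (at t)" using conts(6)[of t] by (simp add: isCont_def)
  have eg3: "eventually (\<lambda>s. g3 s \<noteq> 0) (at t)"
    using tendsto_imp_eventually_ne[OF lg3 g30] .
  have "((\<lambda>s. - (g2 s / (s - t)) / (2 * g3 s * (m s / (s - t)))) \<longlongrightarrow>
      - (p t * g3 t) / (2 * g3 t * (a t * g3 t))) (at t)"
    using at g30 by (intro tendsto_intros lm lg lg3) auto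
  \<comment> \<open>Division by zero gives zero, so both sides agree also when \<open>b\<close> or
    \<open>v\<close> vanishes.\<close>
  moreover have "- (u / c) / (2 * b * (v / c)) = - u / (2 * b * v)" if "c \<noteq> 0" for u v b c :: real
    using that by (cases "b = 0 \<or> v = 0") (auto simp: field_simps)
  then have "eventually (\<lambda>s. - (g2 s / (s - t)) / (2 * g3 s * (m s / (s - t))) =
      - g2 s / (2 * g3 s * m s)) (at t)"
    unfolding eventually_at_filter by (intro always_eventually) simp
  ultimately have "((\<lambda>s. - g2 s / (2 * g3 s * m s)) \<longlongrightarrow>
      - (p t * g3 t) / (2 * g3 t * (a t * g3 t))) (at t)"
    by (rule Lim_transform_eventually)
  then have lr: "((\<lambda>s. r s / Y s) \<longlongrightarrow> - (p t * g3 t) / (2 * g3 t * (a t * g3 t))) (at t)"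
  proof (rule lhopital[rotated -1])
    show "(r \<longlongrightarrow> 0) (at t)" using conts(3)[of t] r0 by (simp add: isCont_def)
    show "(Y \<longlongrightarrow> 0) (at t)" using conts'(1)[of t] Y0 by (simp add: isCont_def)
    show "eventually (\<lambda>s. 2 * g3 s * m s \<noteq> 0) (at t)" using em eg3 by eventually_elim auto
  qed (use eY derivs dY in auto)
  have "((\<lambda>s. - g3 s / 4 * (r s / Y s)) \<longlongrightarrow>
      - g3 t / 4 * (- (p t * g3 t) / (2 * g3 t * (a t * g3 t)))) (at t)"
    by (rule tendsto_mult[OF _ lr]) (intro tendsto_intros lg3, simp)
  then show "((\<lambda>s. n s / Y s) \<longlongrightarrow> p t / (8 * a t)) (at t)"
    using at g30 by (simp add: n_eq field_simps)
qed

text \<open>The value at a pole is defined as the limit, so continuity there is just its existence.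
  This makes the precession angle differentiable at every time, poles included.\<close>

lemma isCont_precession_rate: "isCont (precession_rate x) t"
proof (cases "Y t = 0")
  case True
  have "Lim (at t) (\<lambda>s. node_rate (x s)) = p t / (8 * a t)"
    unfolding node_rate_eq using node_rate_limit(2)[OF True] by (intro tendsto_Lim) auto
  then have "precession_rate x t = p t / (8 * a t)"
    using True unfolding precession_rate_def gamma3_pole by simp
  moreover have "eventually (\<lambda>s. precession_rate x s = n s / Y s) (at t)"
    using node_rate_limit(1)[OF True] by eventually_elim (rule precession_rate_regular)
  ultimately show ?thesis
    using node_rate_limit(2)[OF True] unfolding isCont_def by (simp add: tendsto_cong)
next
  case False
  have lim: "((\<lambda>s. n s / Y s) \<longlongrightarrow> n t / Y t) (at t)"
    using conts'[of t] False unfolding isCont_def by (intro tendsto_intros) auto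
  have "eventually (\<lambda>s. Y s \<noteq> 0) (at t)"
    using conts'(1)[of t] False unfolding isCont_def by (intro tendsto_imp_eventually_ne)
  then have "eventually (\<lambda>s. precession_rate x s = n s / Y s) (at t)"
    by eventually_elim (rule precession_rate_regular)
  then show ?thesis
    using lim precession_rate_regular[OF False] unfolding isCont_def by (simp add: tendsto_cong)
qed

text \<open>Near the poles \<open>\<gamma>\<^sub>3 = \<plusminus>1\<close> the precession rate is unbounded, but \<open>\<plusminus>arctan (n / m)\<close>
  is a bounded function whose derivative cancels its singular part.\<close>

lemma precession_rate_regularized:
  assumes m0: "m t \<noteq> 0" and \<sigma>: "\<sigma> = 1 \<or> \<sigma> = -1" and pos: "\<sigma> * g3 t > 0"
    and P: "(P has_real_derivative precession_rate x t) (at t)"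
  shows "((\<lambda>s. P s + \<sigma> * arctan (n s / m s)) has_real_derivative
      n t / (1 + \<sigma> * g3 t) + \<sigma> * (r t + g3 t * p t / a t) / 4) (at t)"
proof -
  have "(n t)\<^sup>2 + (m t)\<^sup>2 > 0" using m0 by (simp add: sum_power2_gt_zero_iff)
  then have Y: "Y t > 0" using nm[of t] a_pos[of t] by (simp add: zero_less_mult_iff)
  have at: "a t > 0" by (rule a_pos)
  define n' where "n' = (g2 t * g3 t + r t * m t) / 4"
  define m' where "m' = a t * g3 t - (r t * n t + g3 t * g1 t) / 4"
  have "((\<lambda>s. P s + \<sigma> * arctan (n s / m s)) has_real_derivative
      precession_rate x t + \<sigma> * (inverse (1 + (n t / m t)\<^sup>2) * ((n' * m t - n t * m') / (m t * m t)))) (at t)"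
    using m0 unfolding n'_def m'_def by (auto intro!: derivative_eq_intros P dn dm)
  moreover have "inverse (1 + (n t / m t)\<^sup>2) * ((n' * m t - n t * m') / (m t * m t)) =
      (n' * m t - n t * m') / (a t * Y t)"
  proof -
    have "1 + (n t / m t)\<^sup>2 = (a t * Y t) / (m t * m t)"
      unfolding nm[symmetric] using m0 by (simp add: field_simps power2_eq_square)
    then show ?thesis using m0 at Y by (simp add: field_simps)
  qed
  \<comment> \<open>Every term but the first carries a factor \<open>Y\<close>, so after division by
    \<open>a * Y\<close> the only singular part is \<open>- g3 * n / Y\<close>.\<close>
  moreover have "n' * m t - n t * m' = - (a t * g3 t * n t) + Y t * (r t * a t + g3 t * p t) / 4"
  proof -
    have "4 * (n' * m t - n t * m') =
        r t * ((n t)\<^sup>2 + (m t)\<^sup>2) + g3 t * (g2 t * m t + g1 t * n t) - 4 * (a t * g3 t * n t)"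
      unfolding n'_def m'_def by (simp add: field_simps power2_eq_square)
    also have "g2 t * m t + g1 t * n t = p t * Y t"
      unfolding n_def m_def Y_def by algebra
    finally show ?thesis unfolding nm by (simp add: algebra_simps)
  qed
  moreover have "n t / Y t + \<sigma> * ((- (a t * g3 t * n t) + Y t * (r t * a t + g3 t * p t) / 4) / (a t * Y t))
      = n t / (1 + \<sigma> * g3 t) + \<sigma> * (r t + g3 t * p t / a t) / 4"
  proof -
    \<comment> \<open>The sum of the singular parts is \<open>n / Y\<close> times
      \<open>1 - \<sigma> * g3\<close>, which is the factor of \<open>Y\<close> that vanishes at the
      pole; the remaining factor exceeds 1.\<close>
    have Y_fac: "Y t = (1 - \<sigma> * g3 t) * (1 + \<sigma> * g3 t)"
      using \<sigma> by (auto simp: Y_eq power2_eq_square algebra_simps)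
    have cancel: "n t / (A * B) * A = n t / B" if "A * B > 0" for A B :: real
      using that by auto
    have "n t / Y t * (1 - \<sigma> * g3 t) = n t / (1 + \<sigma> * g3 t)"
      unfolding Y_fac by (rule cancel) (use Y Y_fac in simp)
    moreover have "n t / Y t + \<sigma> * ((- (a t * g3 t * n t) + Y t * (r t * a t + g3 t * p t) / 4) / (a t * Y t))
      = n t / Y t * (1 - \<sigma> * g3 t) + \<sigma> * (r t + g3 t * p t / a t) / 4"
      using Y at by (simp add: field_simps)
    ultimately show ?thesis by simp
  qed
  moreover have "precession_rate x t = n t / Y t" using Y by (intro precession_rate_regular) simp
  ultimately show ?thesis by (simp only:)
qed

end

section \<open>Bounded turning over short time intervals\<close>

lemma mvt_abs_bound:
  fixes f :: "real \<Rightarrow> real"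
  assumes "a \<le> b" "\<And>t. t \<in> {a..b} \<Longrightarrow> (f has_real_derivative f' t) (at t)"
    and "\<And>t. t \<in> {a..b} \<Longrightarrow> \<bar>f' t\<bar> \<le> C"
  shows "\<bar>f b - f a\<bar> \<le> C * (b - a)"
proof (cases "a = b")
  case False
  then obtain z where z: "z \<in> {a..b}" "f b - f a = (b - a) * f' z"
    using MVT2[of a b f f'] assms(1,2) by (metis atLeastAtMost_iff less_eq_real_def)
  then show ?thesis
    using assms(1) mult_left_mono[OF assms(3)[OF z(1)], of "b - a"] by (simp add: abs_mult mult_ac)
qed simp

context gc_motion
begin

lemma abs_n_le: "\<bar>n t\<bar> \<le> (\<bar>h\<bar> + 2) / 4"
proof -
  have "\<bar>r t\<bar> * \<bar>g3 t\<bar> \<le> (\<bar>h\<bar> + 2) * 1"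
    using bounds[of t] by (intro mult_mono) auto
  then show ?thesis by (simp add: n_eq abs_mult)
qed

lemma abs_m_le: "\<bar>m t\<bar> \<le> 2 * (\<bar>h\<bar> + 2)"
proof -
  have "\<bar>p t\<bar> * \<bar>g2 t\<bar> \<le> (\<bar>h\<bar> + 2) * 1" "\<bar>q t\<bar> * \<bar>g1 t\<bar> \<le> (\<bar>h\<bar> + 2) * 1"
    using bounds[of t] by (intro mult_mono; simp)+
  moreover have "\<bar>m t\<bar> \<le> \<bar>p t\<bar> * \<bar>g2 t\<bar> + \<bar>q t\<bar> * \<bar>g1 t\<bar>"
    unfolding m_def by (rule order_trans[OF abs_triangle_ineq4]) (simp add: abs_mult)
  ultimately show ?thesis by linarith
qed

text \<open>The regularized angle has a derivative bounded independently of the distance to the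
  pole, and undoing the regularization costs at most \<open>pi\<close>, the width of the range of
  \<open>arctan\<close>. The quotient \<open>n / m\<close> must stay defined on the whole
  interval.\<close>

lemma increment_bound_m_nonzero:
  assumes P: "\<And>t. (P has_real_derivative precession_rate x t) (at t)"
    and ab: "\<alpha> \<le> \<beta>" and m0: "\<And>t. t \<in> {\<alpha>..\<beta>} \<Longrightarrow> m t \<noteq> 0"
    and \<sigma>: "\<sigma> = 1 \<or> \<sigma> = -1" and pos: "\<And>t. t \<in> {\<alpha>..\<beta>} \<Longrightarrow> \<sigma> * g3 t > 0"
    and a0: "a0 > 0" "\<And>t. a0 \<le> a t"
  shows "\<bar>P \<beta> - P \<alpha>\<bar> \<le> (\<bar>h\<bar> + 2) * (1 + 1 / a0) * (\<beta> - \<alpha>) + pi"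
proof -
  define R where "R = \<bar>h\<bar> + 2"
  have R: "R > 0" by (simp add: R_def)
  define E where "E = (\<lambda>s. P s + \<sigma> * arctan (n s / m s))"
  have "\<bar>E \<beta> - E \<alpha>\<bar> \<le> R * (1 + 1 / a0) * (\<beta> - \<alpha>)"
  proof (rule mvt_abs_bound[OF ab])
    fix t assume t: "t \<in> {\<alpha>..\<beta>}"
    show "(E has_real_derivative n t / (1 + \<sigma> * g3 t) + \<sigma> * (r t + g3 t * p t / a t) / 4) (at t)"
      unfolding E_def by (rule precession_rate_regularized[OF m0[OF t] \<sigma> pos[OF t] P])
    have "\<bar>n t / (1 + \<sigma> * g3 t)\<bar> \<le> \<bar>n t\<bar> / 1"
      unfolding abs_divide using pos[OF t] by (intro divide_left_mono) auto
    then have 1: "\<bar>n t / (1 + \<sigma> * g3 t)\<bar> \<le> R / 4"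
      using abs_n_le[of t] unfolding R_def by linarith
    define z where "z = g3 t * p t / a t"
    have "\<bar>g3 t\<bar> * \<bar>p t\<bar> \<le> 1 * R"
      using bounds[of t] by (intro mult_mono) (auto simp: R_def)
    then have "\<bar>z\<bar> \<le> R / a0"
      unfolding z_def abs_divide abs_mult abs_of_pos[OF a_pos] using a0(1) a0(2)[of t] R
      by (intro frac_le) simp_all
    moreover have "\<bar>r t\<bar> \<le> R" using bounds[of t] by (simp add: R_def)
    ultimately have "\<bar>r t + z\<bar> \<le> R + R / a0" by linarith
    moreover have "\<bar>\<sigma> * (r t + z) / 4\<bar> = \<bar>r t + z\<bar> / 4"
      using \<sigma> by auto
    ultimately have 2: "\<bar>\<sigma> * (r t + z) / 4\<bar> \<le> (R + R / a0) / 4" by simp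
    have eq: "R * (1 + 1 / a0) = R + R / a0" by (simp add: algebra_simps)
    have "R / 4 + (R + w) / 4 \<le> R + w" if "w > 0" for w
      using that R by (simp add: field_simps)
    then have 3: "R / 4 + (R + R / a0) / 4 \<le> R * (1 + 1 / a0)"
      unfolding eq using R a0 by simp
    show "\<bar>n t / (1 + \<sigma> * g3 t) + \<sigma> * (r t + g3 t * p t / a t) / 4\<bar> \<le> R * (1 + 1 / a0)"
      unfolding z_def[symmetric]
      by (rule order_trans[OF order_trans[OF abs_triangle_ineq add_mono[OF 1 2]] 3])
  qed
  moreover have "P \<beta> - P \<alpha> = (E \<beta> - E \<alpha>) - \<sigma> * (arctan (n \<beta> / m \<beta>) - arctan (n \<alpha> / m \<alpha>))"
    unfolding E_def by (simp add: algebra_simps)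
  moreover have "\<bar>\<sigma> * (arctan (n \<beta> / m \<beta>) - arctan (n \<alpha> / m \<alpha>))\<bar> \<le> pi"
    using \<sigma> arctan_bounded[of "n \<beta> / m \<beta>"] arctan_bounded[of "n \<alpha> / m \<alpha>"] by auto
  ultimately show ?thesis unfolding R_def by linarith
qed

text \<open>The second bound on \<kappa> makes \<open>m\<close> strictly monotone, so it vanishes at
  most once and the interval splits into at most two pieces on which the regularization applies. The
  first bound on \<kappa> keeps \<open>g3\<close> away from zero, hence of one sign.\<close>

lemma increment_bound_near_pole:
  assumes P: "\<And>t. (P has_real_derivative precession_rate x t) (at t)"
    and ab: "\<alpha> \<le> \<beta>"
    and \<kappa>: "\<kappa> \<le> 1 / 2" "\<kappa> \<le> (a0 / (2 * (\<bar>h\<bar> + 2)\<^sup>2 + 1))\<^sup>2"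
    and Y\<kappa>: "\<And>t. t \<in> {\<alpha>..\<beta>} \<Longrightarrow> Y t \<le> \<kappa>"
    and a0: "a0 > 0" "\<And>t. a0 \<le> a t"
  shows "\<bar>P \<beta> - P \<alpha>\<bar> \<le> 2 * ((\<bar>h\<bar> + 2) * (1 + 1 / a0) * (\<beta> - \<alpha>) + pi) + 2"
proof -
  define R where "R = \<bar>h\<bar> + 2"
  have R: "R > 0" by (simp add: R_def)
  define B where "B = R * (1 + 1 / a0) * (\<beta> - \<alpha>) + pi"
  have C0: "R * (1 + 1 / a0) > 0" using R a0 by (intro mult_pos_pos add_pos_pos) auto
  then have B0: "B \<ge> 0" using ab by (simp add: B_def)
  have g3_sq: "(g3 t)\<^sup>2 \<ge> 1 / 2" if "t \<in> {\<alpha>..\<beta>}" for t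
    using Y\<kappa>[OF that] \<kappa>(1) by (simp add: Y_eq)
  have "continuous_on {\<alpha>..\<beta>} g3"
    using conts(6) by (intro continuous_at_imp_continuous_on) auto
  moreover have "g3 t \<noteq> 0" if "t \<in> {\<alpha>..\<beta>}" for t using g3_sq[OF that] by auto
  ultimately obtain \<sigma> where \<sigma>: "\<sigma> = 1 \<or> \<sigma> = -1" and pos: "\<And>t. t \<in> {\<alpha>..\<beta>} \<Longrightarrow> \<sigma> * g3 t > 0"
    using continuous_nonzero_sign[of \<alpha> \<beta> g3] by blast
  have half: "\<sigma> * g3 t \<ge> 1 / 2" if t: "t \<in> {\<alpha>..\<beta>}" for t
  proof -
    have "(\<sigma> * g3 t)\<^sup>2 = (g3 t)\<^sup>2" using \<sigma> by (elim disjE) simp_all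
    then have "(1 / 2)\<^sup>2 \<le> (\<sigma> * g3 t)\<^sup>2" using g3_sq[OF t] by (simp add: power_divide)
    then show ?thesis by (rule power2_le_imp_le) (use pos[OF t] in simp)
  qed
  define m' where "m' t = a t * g3 t - (r t * n t + g3 t * g1 t) / 4" for t
  have m'_pos: "\<sigma> * m' t > 0" if t: "t \<in> {\<alpha>..\<beta>}" for t
  proof -
    \<comment> \<open>Solves \<open>R * (2 * R * y) + y = a0\<close>: the correction in
      \<open>m'\<close> is then at most \<open>a0 / 4\<close>, while its leading term
      \<open>a * g3\<close> is at least \<open>a0 / 2\<close> in absolute value.\<close>
    define y where "y = a0 / (2 * R\<^sup>2 + 1)"
    have y: "y > 0" using a0 R by (simp add: y_def add_nonneg_pos)
    have Yy: "Y t \<le> y\<^sup>2" using Y\<kappa>[OF t] \<kappa>(2) by (simp add: y_def R_def)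
    have g1y: "\<bar>g1 t\<bar> \<le> y"
    proof -
      have "\<bar>g1 t\<bar>\<^sup>2 \<le> y\<^sup>2" using Yy zero_le_power2[of "g2 t"] unfolding Y_def by (simp only: power2_abs)
      then show ?thesis by (rule power2_le_imp_le) (use y in simp)
    qed
    have ny: "\<bar>n t\<bar> \<le> 2 * R * y"
    proof -
      have "\<bar>p t\<bar>\<^sup>2 \<le> R\<^sup>2" "\<bar>q t\<bar>\<^sup>2 \<le> R\<^sup>2"
        using bounds[of t] by (intro power_mono; simp add: R_def)+
      then have "a t \<le> 2 * R\<^sup>2" unfolding a_def by simp
      then have "a t * Y t \<le> 2 * R\<^sup>2 * y\<^sup>2"
        using Yy R Y_nonneg by (intro mult_mono) auto
      moreover have "\<bar>n t\<bar>\<^sup>2 \<le> a t * Y t" unfolding nm[symmetric] by simp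
      ultimately have "\<bar>n t\<bar>\<^sup>2 \<le> 2 * R\<^sup>2 * y\<^sup>2" by (rule order_trans[rotated])
      also have "\<dots> \<le> (2 * R * y)\<^sup>2" by (simp add: power_mult_distrib)
      finally show ?thesis by (rule power2_le_imp_le) (use y R in simp)
    qed
    have "\<bar>r t * n t + g3 t * g1 t\<bar> \<le> \<bar>r t\<bar> * \<bar>n t\<bar> + \<bar>g3 t\<bar> * \<bar>g1 t\<bar>"
      by (rule order_trans[OF abs_triangle_ineq]) (simp add: abs_mult)
    also have "\<dots> \<le> R * (2 * R * y) + 1 * y"
      by (rule add_mono; rule mult_mono)
        (use bounds(3)[of t, folded R_def] bounds(6)[of t] ny g1y R y in simp_all)
    also have "\<dots> = y * (2 * R\<^sup>2 + 1)" by (simp add: power2_eq_square algebra_simps)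
    also have "\<dots> = a0" unfolding y_def using R
      by (simp add: add_nonneg_eq_0_iff)
    finally have err: "\<bar>r t * n t + g3 t * g1 t\<bar> \<le> a0" .
    have "a0 * (1 / 2) \<le> a t * (\<sigma> * g3 t)"
      by (rule mult_mono) (use half[OF t] a0(1) a0(2)[of t] in simp_all)
    show ?thesis
    proof -
      have "\<sigma> * m' t = a t * (\<sigma> * g3 t) - \<sigma> * (r t * n t + g3 t * g1 t) / 4"
        unfolding m'_def by (simp add: algebra_simps)
      moreover have "\<bar>\<sigma> * (r t * n t + g3 t * g1 t)\<bar> \<le> a0"
        using \<sigma> err by (elim disjE) simp_all
      moreover have "u - v / 4 > 0" if "a0 * (1 / 2) \<le> u" "\<bar>v\<bar> \<le> a0" for u v
        using that a0(1) by (simp add: field_simps)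
      ultimately show ?thesis using \<open>a0 * (1 / 2) \<le> a t * (\<sigma> * g3 t)\<close> by presburger
    qed
  qed
  have mono: "\<sigma> * m s < \<sigma> * m t" if "s \<in> {\<alpha>..\<beta>}" "t \<in> {\<alpha>..\<beta>}" "s < t" for s t
  proof (rule DERIV_pos_imp_increasing[OF that(3)])
    fix u assume "s \<le> u" "u \<le> t"
    then show "\<exists>D. ((\<lambda>t. \<sigma> * m t) has_real_derivative D) (at u) \<and> 0 < D"
      using that m'_pos[of u] by (intro exI[of _ "\<sigma> * m' u"] conjI DERIV_cmult) (auto simp: m'_def intro: dm)
  qed
  have sub: "\<bar>P \<beta>' - P \<alpha>'\<bar> \<le> B"
    if "\<alpha> \<le> \<alpha>'" "\<alpha>' \<le> \<beta>'" "\<beta>' \<le> \<beta>" and m0: "\<And>t. t \<in> {\<alpha>'..\<beta>'} \<Longrightarrow> m t \<noteq> 0" for \<alpha>' \<beta>'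
  proof -
    have "\<bar>P \<beta>' - P \<alpha>'\<bar> \<le> R * (1 + 1 / a0) * (\<beta>' - \<alpha>') + pi"
      unfolding R_def by (rule increment_bound_m_nonzero[OF P that(2) m0 \<sigma> _ a0]) (use pos that in auto)
    also have "\<dots> \<le> B" unfolding B_def using C0 that by (intro add_mono mult_left_mono) auto
    finally show ?thesis .
  qed
  have "\<bar>P \<beta> - P \<alpha>\<bar> \<le> 2 * B + 2"
  proof (cases "\<exists>u\<in>{\<alpha>..\<beta>}. m u = 0")
    case False
    then show ?thesis using sub[of \<alpha> \<beta>] ab B0 by auto
  next
    case True
    then obtain u where u: "u \<in> {\<alpha>..\<beta>}" "m u = 0" by blast
    have only: "m t \<noteq> 0" if "t \<in> {\<alpha>..\<beta>}" "t \<noteq> u" for t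
      using mono[of t u] mono[of u t] that u by (cases t u rule: linorder_cases) auto
    \<comment> \<open>At the zero of \<open>m\<close> the quotient \<open>n / m\<close> breaks down,
      but \<open>P\<close> is continuous. A short interval around \<open>u\<close> on which
      \<open>P\<close> differs by less than 1 from \<open>P u\<close> is cut out; its two halves
      account for the summand 2, and its length does not enter the bound.\<close>
    have "isCont P u" using P by (rule DERIV_isCont)
    then obtain d where d: "d > 0" "\<And>s. \<bar>s - u\<bar> < d \<Longrightarrow> \<bar>P s - P u\<bar> < 1"
      unfolding continuous_at_eps_delta dist_real_def by (meson zero_less_one)
    define lo hi where "lo = max \<alpha> (u - d / 2)" and "hi = min \<beta> (u + d / 2)"
    have "\<bar>P lo - P u\<bar> < 1" "\<bar>P hi - P u\<bar> < 1"
      using d(1) u(1) by (intro d(2); auto simp: lo_def hi_def)+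
    moreover have "\<bar>P lo - P \<alpha>\<bar> \<le> B"
    proof (cases "u - d / 2 \<le> \<alpha>")
      case True
      then show ?thesis using B0 by (simp add: lo_def)
    next
      case False
      then show ?thesis using u(1) d(1) by (intro sub only) (auto simp: lo_def)
    qed
    moreover have "\<bar>P \<beta> - P hi\<bar> \<le> B"
    proof (cases "\<beta> \<le> u + d / 2")
      case True
      then show ?thesis using B0 by (simp add: hi_def)
    next
      case False
      then show ?thesis using u(1) d(1) by (intro sub only) (auto simp: hi_def)
    qed
    ultimately show ?thesis by linarith
  qed
  then show ?thesis unfolding B_def R_def .
qed

text \<open>An interval of length at most \<delta> either stays in the region \<open>Y \<le>\<close>
  \<kappa>, where the estimate near the pole holds, or in the region \<open>Y \<ge>\<close>
  \<kappa>\<open>/ 2\<close>, where the rate itself is bounded.\<close>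

lemma increment_bound:
  assumes P: "\<And>t. (P has_real_derivative precession_rate x t) (at t)"
  obtains \<delta> C where "\<delta> > 0" "\<And>t s. 0 \<le> s \<Longrightarrow> s \<le> \<delta> \<Longrightarrow> \<bar>P (t + s) - P t\<bar> \<le> C"
proof -
  obtain a0 where a0: "a0 > 0"
    "\<And>p q r g1 g2 g3. (p, q, r, g1, g2, g3) \<in> level_set h k \<Longrightarrow> a0 \<le> p\<^sup>2 + q\<^sup>2"
    by (rule level_set_horizontal_lower[OF k, of h], rule that)
  have a0': "a0 \<le> a t" for t using a0(2) lev[of t] unfolding a_def x_eq by blast
  define R where "R = \<bar>h\<bar> + 2"
  have R: "R > 0" by (simp add: R_def)
  define \<kappa> where "\<kappa> = min (1 / 2) ((a0 / (2 * R\<^sup>2 + 1))\<^sup>2)"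
  have "2 * R\<^sup>2 + 1 \<noteq> 0" by (simp add: add_nonneg_eq_0_iff)
  then have \<kappa>: "\<kappa> > 0" using a0 by (simp add: \<kappa>_def)
  \<comment> \<open>The derivative of \<open>Y\<close> is at most \<open>4 * R\<close>, so
    \<open>Y\<close> changes by at most \<kappa>\<open>/ 2\<close> within time \<delta>.\<close>
  define \<delta> where "\<delta> = \<kappa> / (8 * R)"
  have \<delta>: "\<delta> > 0" using \<kappa> R by (simp add: \<delta>_def)
  define B where "B = 2 * (R * (1 + 1 / a0) * \<delta> + pi) + 2"
  define D where "D = R / 4 / (\<kappa> / 2)"
  have D0: "D \<ge> 0" using R \<kappa> by (simp add: D_def)
  have C0: "R * (1 + 1 / a0) > 0" using R a0 by (intro mult_pos_pos add_pos_pos) auto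
  then have B0: "B \<ge> 0" using \<delta> by (simp add: B_def)
  have dist_Y: "\<bar>Y u - Y v\<bar> \<le> \<kappa> / 2" if "\<bar>u - v\<bar> \<le> \<delta>" for u v
  proof -
    have "\<bar>Y b - Y c\<bar> \<le> \<kappa> / 2" if "c \<le> b" "b - c \<le> \<delta>" for b c
    proof -
      have "\<bar>Y b - Y c\<bar> \<le> 4 * R * (b - c)"
      proof (rule mvt_abs_bound[OF that(1) dY])
        fix t
        have "\<bar>g3 t\<bar> * \<bar>m t\<bar> \<le> 1 * (2 * R)"
          using abs_m_le[of t] bounds[of t] by (intro mult_mono) (auto simp: R_def)
        then show "\<bar>2 * g3 t * m t\<bar> \<le> 4 * R" by (simp add: abs_mult)
      qed
      also have "\<dots> \<le> 4 * R * \<delta>" using that R by (intro mult_left_mono) auto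
      also have "\<dots> = \<kappa> / 2" using R by (simp add: \<delta>_def)
      finally show ?thesis .
    qed
    from this[of u v] this[of v u] that show ?thesis by linarith
  qed
  have "\<bar>P (t + s) - P t\<bar> \<le> B + D * \<delta>" if s: "0 \<le> s" "s \<le> \<delta>" for s t
  proof (cases "\<exists>u\<in>{t..t + s}. Y u < \<kappa> / 2")
    case True
    then obtain u where u: "u \<in> {t..t + s}" "Y u < \<kappa> / 2" by blast
    have "Y v \<le> \<kappa>" if "v \<in> {t..t + s}" for v
    proof -
      have "\<bar>Y v - Y u\<bar> \<le> \<kappa> / 2" using that u(1) s by (intro dist_Y) auto
      then show ?thesis using u(2) by linarith
    qed
    then have "\<bar>P (t + s) - P t\<bar> \<le> 2 * (R * (1 + 1 / a0) * ((t + s) - t) + pi) + 2"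
      unfolding R_def using s
      by (intro increment_bound_near_pole[OF P _ _ _ _ a0(1) a0', of _ _ \<kappa>]) (auto simp: \<kappa>_def R_def)
    also have "\<dots> \<le> B" unfolding B_def using C0 mult_left_mono[OF s(2), of "R * (1 + 1 / a0)"] by simp
    finally show ?thesis using D0 \<delta> by (simp add: add_increasing2)
  next
    case False
    have "\<bar>P (t + s) - P t\<bar> \<le> D * ((t + s) - t)"
    proof (rule mvt_abs_bound[OF _ P])
      fix u assume "u \<in> {t..t + s}"
      then have Y: "Y u \<ge> \<kappa> / 2" using False by force
      then have "precession_rate x u = n u / Y u"
        using \<kappa> by (intro precession_rate_regular) auto
      moreover have "\<bar>n u / Y u\<bar> \<le> D"
        unfolding D_def abs_divide using Y \<kappa> abs_n_le[of u] by (intro frac_le) (auto simp: R_def)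
      ultimately show "\<bar>precession_rate x u\<bar> \<le> D" by simp
    qed (use s in simp)
    also have "\<dots> \<le> D * \<delta>" using D0 s by (simp add: mult_left_mono)
    finally show ?thesis using B0 by simp
  qed
  then show thesis by (rule that[OF \<delta>])
qed

end

subsection \<open>Averaging\<close>

text \<open>The constant \<open>K\<close> is the same for all \<eta> and \<open>L\<close>, so its
  share per unit time disappears as windows grow. The shift \<tau> does depend on the window, but by
  \<open>inc\<close> replacing \<open>P (t +\<close> \<tau>\<open>)\<close> by \<open>P t\<close>
  costs an amount independent of \<open>t\<close>, which is lost on division by
  \<open>t\<close>.\<close>

lemma sublinear_of_windows:
  fixes P :: "real \<Rightarrow> real"
  assumes \<delta>: "\<delta> > 0" and inc: "\<And>t s. 0 \<le> s \<Longrightarrow> s \<le> \<delta> \<Longrightarrow> \<bar>P (t + s) - P t\<bar> \<le> C"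
    and win: "\<And>\<eta> L. \<eta> > 0 \<Longrightarrow> (L :: nat) > 0 \<Longrightarrow>
      \<exists>\<tau>. \<forall>u. \<bar>P (u + L * \<delta>) + P (u + L * \<delta> + \<tau>) - (P u + P (u + \<tau>))\<bar> \<le> \<eta> * (L * \<delta>) + K"
  shows "((\<lambda>t. P t / t) \<longlongrightarrow> 0) at_top"
proof -
  have C0: "C \<ge> 0" using inc[of 0 0] \<delta> by simp
  have steps: "\<bar>P (t + real n * \<delta>) - P t\<bar> \<le> C * real n" for t n
  proof (induction n)
    case (Suc n)
    have "\<bar>P (t + real n * \<delta> + \<delta>) - P (t + real n * \<delta>)\<bar> \<le> C" using \<delta> by (intro inc) auto
    then show ?case using Suc.IH by (simp add: algebra_simps)
  qed simp
  have long: "\<bar>P (t + s) - P t\<bar> \<le> C * (s / \<delta> + 1)" if "s \<ge> 0" for s t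
  proof -
    define n where "n = nat \<lfloor>s / \<delta>\<rfloor>"
    have n: "real n \<le> s / \<delta>" "s / \<delta> \<le> real n + 1" using that \<delta> by (auto simp: n_def)
    then have n': "real n * \<delta> \<le> s" "s \<le> real n * \<delta> + \<delta>" using \<delta> by (auto simp: field_simps)
    have "\<bar>P (t + real n * \<delta> + (s - real n * \<delta>)) - P (t + real n * \<delta>)\<bar> \<le> C"
      using n' by (intro inc) auto
    then have "\<bar>P (t + s) - P (t + real n * \<delta>)\<bar> \<le> C" by (simp add: algebra_simps)
    then have "\<bar>P (t + s) - P t\<bar> \<le> C * real n + C" using steps[of t n] by linarith
    also have "\<dots> \<le> C * (s / \<delta> + 1)" using mult_left_mono[OF n(1) C0] by (simp add: algebra_simps)
    finally show ?thesis .
  qed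
  have shift: "\<bar>P (t + s) - P t\<bar> \<le> C * (\<bar>s\<bar> / \<delta> + 1)" for s t
    using long[of s t] long[of "- s" "t + s"] by (cases "s \<ge> 0") (auto simp: abs_minus_commute)
  show ?thesis
    unfolding tendsto_iff
  proof (intro allI impI)
    fix e :: real assume e: "e > 0"
    \<comment> \<open>Large enough that \<open>K\<close> is at most half of the allowance
      \<open>e * N\<close> of a window; the other half is spent on
      \<open>\<eta> = e / 2\<close>.\<close>
    define L where "L = nat \<lceil>2 * \<bar>K\<bar> / (e * \<delta>)\<rceil> + 1"
    define N where "N = real L * \<delta>"
    have L: "L > 0" by (simp add: L_def)
    have N: "N > 0" using L \<delta> by (simp add: N_def)
    have "2 * \<bar>K\<bar> / (e * \<delta>) \<le> real L" by (simp add: L_def) linarith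
    then have K: "\<bar>K\<bar> \<le> e / 2 * N" using e \<delta> by (simp add: N_def field_simps)
    obtain \<tau> where \<tau>: "\<And>u. \<bar>P (u + N) + P (u + N + \<tau>) - (P u + P (u + \<tau>))\<bar> \<le> e / 2 * N + K"
      using win[of "e / 2" L] e L unfolding N_def by auto
    define Q where "Q t = P t + P (t + \<tau>)" for t
    have Q: "\<bar>Q (u + N) - Q u\<bar> \<le> e * N" for u
      using \<tau>[of u] K unfolding Q_def by linarith
    have Qj: "\<bar>Q (real j * N) - Q 0\<bar> \<le> e * (real j * N)" for j
    proof (induction j)
      case (Suc j)
      then show ?case using Q[of "real j * N"] by (simp add: algebra_simps)
    qed simp
    \<comment> \<open>The three summands are the initial value of \<open>Q\<close>, the incomplete
      last window for both terms of \<open>Q\<close>, and the passage from \<open>Q t\<close> to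
      \<open>2 * P t\<close>.\<close>
    define M where "M = \<bar>Q 0\<bar> + 2 * (C * (N / \<delta> + 1)) + C * (\<bar>\<tau>\<bar> / \<delta> + 1)"
    have bound: "2 * \<bar>P t\<bar> \<le> e * t + M" if t: "t \<ge> 0" for t
    proof -
      define j where "j = nat \<lfloor>t / N\<rfloor>"
      have "real j \<le> t / N" "t / N \<le> real j + 1" using t N by (auto simp: j_def)
      then have j: "real j * N \<le> t" "t \<le> real j * N + N" using N by (auto simp: field_simps)
      define s where "s = t - real j * N"
      have s: "0 \<le> s" "s \<le> N" "real j * N + s = t" using j by (auto simp: s_def)
      have CN: "C * (s / \<delta> + 1) \<le> C * (N / \<delta> + 1)"
        using s \<delta> C0 by (intro mult_left_mono add_right_mono divide_right_mono) auto
      define c1 c2 where "c1 = C * (N / \<delta> + 1)" and "c2 = C * (\<bar>\<tau>\<bar> / \<delta> + 1)"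
      have 1: "\<bar>P t - P (real j * N)\<bar> \<le> c1"
        using order_trans[OF long[OF s(1), of "real j * N"] CN] unfolding s(3) c1_def .
      have shifted: "real j * N + \<tau> + s = t + \<tau>" using s(3) by simp
      have 2: "\<bar>P (t + \<tau>) - P (real j * N + \<tau>)\<bar> \<le> c1"
        using order_trans[OF long[OF s(1), of "real j * N + \<tau>"] CN] unfolding shifted c1_def .
      have 3: "\<bar>P (t + \<tau>) - P t\<bar> \<le> c2" unfolding c2_def by (rule shift)
      have "\<bar>Q (real j * N)\<bar> \<le> \<bar>Q 0\<bar> + e * (real j * N)" using Qj[of j] by linarith
      also have "e * (real j * N) \<le> e * t" using j e by (intro mult_left_mono) auto
      finally have "\<bar>P (real j * N) + P (real j * N + \<tau>)\<bar> \<le> \<bar>Q 0\<bar> + e * t" by (simp add: Q_def)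
      with 1 2 3 have "2 * \<bar>P t\<bar> \<le> e * t + (\<bar>Q 0\<bar> + 2 * c1 + c2)" by linarith
      then show ?thesis unfolding M_def c1_def c2_def .
    qed
    have "eventually (\<lambda>t. t > max 0 (M / e)) at_top" by (rule eventually_gt_at_top)
    then show "eventually (\<lambda>t. dist (P t / t) 0 < e) at_top"
    proof eventually_elim
      case (elim t)
      then have "M < e * t" using e by (simp add: field_simps)
      then have "\<bar>P t\<bar> < e * t" using bound[of t] elim by simp
      then show ?case using elim by (simp add: field_simps)
    qed
  qed
qed

lemma has_real_derivative_LBINT:
  fixes f :: "real \<Rightarrow> real"
  assumes "\<And>t. isCont f t"
  shows "((\<lambda>u. LBINT s=ereal c..ereal u. f s) has_real_derivative f t) (at t)"
proof -
  define a b where "a = min c t - 1" and "b = max c t + 1"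
  have "((\<lambda>u. LBINT s=ereal c..ereal u. f s) has_vector_derivative f t) (at t within {a..b})"
    using assms by (intro interval_integral_FTC2 continuous_at_imp_continuous_on) (auto simp: a_def b_def)
  then have "((\<lambda>u. LBINT s=ereal c..ereal u. f s) has_vector_derivative f t) (at t within {a<..<b})"
    by (rule has_vector_derivative_within_subset) auto
  moreover have t: "t \<in> {a<..<b}" by (auto simp: a_def b_def)
  ultimately show ?thesis
    by (simp only: has_vector_derivative_within_open[OF t open_greaterThanLessThan]
        has_real_derivative_iff_has_vector_derivative)
qed

lemma has_main_motion_zero:
  assumes "((\<lambda>t. \<psi> t / t) \<longlongrightarrow> 0) at_top"
  shows "has_main_motion \<psi> 0"
  unfolding has_main_motion_def
proof (rule smalloI_tendsto)
  have "((\<lambda>t. \<psi> t / t - \<psi> 0 / t) \<longlongrightarrow> 0 - 0) at_top"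
    using assms by (intro tendsto_diff tendsto_divide_0[OF tendsto_const] filterlim_at_top_imp_at_infinity filterlim_ident)
  then show "((\<lambda>t. (\<psi> t - \<psi> 0 - 0 * t) / t) \<longlongrightarrow> 0) at_top"
    by (simp add: diff_divide_distrib)
  show "eventually (\<lambda>t :: real. t \<noteq> 0) at_top" 
    using eventually_gt_at_top[of 0] by eventually_elim simp
qed

section \<open>Irrational windings of the torus: recurrence and absence of early returns\<close>

locale irrational_winding =
  fixes T :: "state set" and h k :: real and \<Phi> :: "real \<times> real \<Rightarrow> state" and \<omega>1 \<omega>2 :: real
  assumes angles: "angle_coordinates T \<Phi> \<omega>1 \<omega>2" and T_sub: "T \<subseteq> level_set h k"
    and indep: "rationally_independent \<omega>1 \<omega>2"
begin

lemma range_\<Phi>: "range \<Phi> = T"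
  using angles by (simp add: angle_coordinates_def)

lemma \<Phi>_eq_iff: "\<Phi> (a1, a2) = \<Phi> (b1, b2) \<longleftrightarrow>
    (\<exists>m n :: int. a1 - b1 = 2 * pi * of_int m \<and> a2 - b2 = 2 * pi * of_int n)"
  using angles by (simp add: angle_coordinates_def)

lemma \<Phi>_solution: "gc_solution (\<lambda>t. \<Phi> (a1 + \<omega>1 * t, a2 + \<omega>2 * t))"
  using angles by (simp add: angle_coordinates_def)

lemma \<Phi>_continuous: "continuous_on A \<Phi>"
  using angles unfolding angle_coordinates_def
  by (metis continuous_at_imp_continuous_on has_derivative_continuous)

lemma \<Phi>_level_set: "\<Phi> a \<in> level_set h k"
  using range_\<Phi> T_sub by blast

lemma solution_angles:
  assumes "gc_solution x" "\<And>t. x t \<in> level_set h k" "x 0 \<in> T"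
  obtains a1 a2 where "\<And>t. x t = \<Phi> (a1 + \<omega>1 * t, a2 + \<omega>2 * t)"
proof -
  obtain a1 a2 where "x 0 = \<Phi> (a1, a2)" using assms(3) range_\<Phi> by (metis imageE surj_pair)
  then have "x t = \<Phi> (a1 + \<omega>1 * t, a2 + \<omega>2 * t)" for t
    using gc_solution_unique[where y = "\<lambda>t. \<Phi> (a1 + \<omega>1 * t, a2 + \<omega>2 * t)",
        OF assms(1) \<Phi>_solution assms(2) \<Phi>_level_set] by simp
  then show thesis by (rule that)
qed

lemma freq_not_zero: "\<omega>1 \<noteq> 0"
proof
  assume "\<omega>1 = 0"
  then show False
    using indep[unfolded rationally_independent_def, rule_format, of 1 0] by simp
qed

lemma freq_ratio_irrational: "\<omega>2 / \<omega>1 \<notin> \<rat>"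
proof
  assume "\<omega>2 / \<omega>1 \<in> \<rat>"
  then show False
    using indep[unfolded rationally_independent_def, rule_format, of "\<omega>2 / \<omega>1" "-1"] freq_not_zero
    by simp
qed

text \<open>A return makes both angle increments integer multiples of \<open>2 * pi\<close>;
  eliminating the time yields an integer relation between the frequencies.\<close>

lemma not_periodic:
  assumes "\<Phi> (a1 + \<omega>1 * t, a2 + \<omega>2 * t) = \<Phi> (a1, a2)"
  shows "t = 0"
proof (rule ccontr)
  assume t: "t \<noteq> 0"
  obtain m n :: int where mn: "\<omega>1 * t = 2 * pi * of_int m" "\<omega>2 * t = 2 * pi * of_int n"
    using assms unfolding \<Phi>_eq_iff by auto
  have "t * (of_int n * \<omega>1 + - of_int m * \<omega>2) = 0" using mn by algebra
  then have "of_int n * \<omega>1 + - of_int m * \<omega>2 = 0" using t by simp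
  then have "m = 0"
    using indep[unfolded rationally_independent_def, rule_format, of "of_int n" "- of_int m"] by simp
  then show False using mn(1) t freq_not_zero by simp
qed

lemma \<Phi>_shift: "\<Phi> (a1 + 2 * pi * of_int m, a2 + 2 * pi * of_int n) = \<Phi> (a1, a2)"
  unfolding \<Phi>_eq_iff by (intro exI[of _ m] exI[of _ n]) simp

lemma \<Phi>_uniformly_continuous:
  assumes "\<epsilon> > 0"
  obtains d where "d > 0"
    "\<And>a1 a2 b1 b2. \<bar>a1 - b1\<bar> < d \<Longrightarrow> \<bar>a2 - b2\<bar> < d \<Longrightarrow> dist (\<Phi> (a1, a2)) (\<Phi> (b1, b2)) < \<epsilon>"
proof -
  \<comment> \<open>The period square with a margin of 1: a common translation brings one point into
    the square, and the other, less than 1 away in each angle, stays in \<open>S\<close>.\<close>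
  define S where "S = {-1..2 * pi + 1} \<times> {-1..2 * pi + 1}"
  have "compact S" unfolding S_def by (intro compact_Times) auto
  then have "uniformly_continuous_on S \<Phi>" by (intro compact_uniformly_continuous \<Phi>_continuous)
  then obtain e where e: "e > 0" "\<And>u v. u \<in> S \<Longrightarrow> v \<in> S \<Longrightarrow> dist v u < e \<Longrightarrow> dist (\<Phi> v) (\<Phi> u) < \<epsilon>"
    unfolding uniformly_continuous_on_def using assms by metis
  have "dist (\<Phi> (a1, a2)) (\<Phi> (b1, b2)) < \<epsilon>"
    if d: "\<bar>a1 - b1\<bar> < min 1 (e / 2)" "\<bar>a2 - b2\<bar> < min 1 (e / 2)" for a1 a2 b1 b2
  proof -
    have red: "\<exists>m :: int. a + 2 * pi * of_int m \<in> {0..2 * pi}" for a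
    proof
      define m where "m = - \<lfloor>a / (2 * pi)\<rfloor>"
      have "of_int (- m) \<le> a / (2 * pi)" "a / (2 * pi) \<le> of_int (- m) + 1" by (auto simp: m_def)
      then show "a + 2 * pi * of_int m \<in> {0..2 * pi}" by (auto simp: field_simps)
    qed
    obtain m n :: int where mn: "a1 + 2 * pi * of_int m \<in> {0..2 * pi}" "a2 + 2 * pi * of_int n \<in> {0..2 * pi}"
      using red by metis
    define u v where "u = (a1 + 2 * pi * of_int m, a2 + 2 * pi * of_int n)"
      and "v = (b1 + 2 * pi * of_int m, b2 + 2 * pi * of_int n)"
    have "u \<in> S" "v \<in> S" using mn d by (auto simp: u_def v_def S_def)
    moreover have "dist u v < e"
    proof -
      have "u - v = (a1 - b1, a2 - b2)" by (simp add: u_def v_def)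
      then have "dist u v \<le> \<bar>a1 - b1\<bar> + \<bar>a2 - b2\<bar>"
        unfolding dist_norm using norm_Pair_le[of "a1 - b1" "a2 - b2"] by simp
      then show ?thesis using d by linarith
    qed
    ultimately have "dist (\<Phi> u) (\<Phi> v) < \<epsilon>" by (intro e(2))
    then show ?thesis unfolding u_def v_def \<Phi>_shift .
  qed
  then show thesis using e(1) by (intro that[of "min 1 (e / 2)"]) auto
qed

text \<open>Two windings with the same frequencies keep a constant phase difference, so closeness at
  one time is closeness at all times. It remains to hit a prescribed phase difference approximately
  by a time shift.\<close>

lemma uniform_recurrence:
  assumes "\<epsilon> > 0"
  obtains \<tau> where "\<And>t. dist (\<Phi> (a1 + \<omega>1 * (t + \<tau>), a2 + \<omega>2 * (t + \<tau>))) (\<Phi> (b1 + \<omega>1 * t, b2 + \<omega>2 * t)) < \<epsilon>"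
proof -
  obtain d where d: "d > 0"
    "\<And>a1 a2 b1 b2. \<bar>a1 - b1\<bar> < d \<Longrightarrow> \<bar>a2 - b2\<bar> < d \<Longrightarrow> dist (\<Phi> (a1, a2)) (\<Phi> (b1, b2)) < \<epsilon>"
    by (rule \<Phi>_uniformly_continuous[OF assms], rule that)
  define \<theta> where "\<theta> = \<omega>2 / \<omega>1"
  have \<omega>2: "\<omega>2 = \<theta> * \<omega>1" using freq_not_zero by (simp add: \<theta>_def)
  define \<alpha> where "\<alpha> = (b2 - a2 - \<theta> * (b1 - a1)) / (2 * pi)"
  obtain n m :: int where mn: "\<bar>of_int m * \<theta> - of_int n - \<alpha>\<bar> < d / (2 * pi)"
    by (rule sequence_of_fractional_parts_is_dense[of \<theta> "d / (2 * pi)" \<alpha>])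
      (rule freq_ratio_irrational[folded \<theta>_def], use d(1) in simp, rule that)
  \<comment> \<open>These shifts match the first angle exactly modulo \<open>2 * pi\<close>, for any
    integer \<open>m\<close>. The choice of \<open>m\<close>, by density of the fractional parts of
    its multiples of \<theta>, matches the second angle within \<open>d\<close>.\<close>
  define \<tau> where "\<tau> = (b1 - a1 + 2 * pi * of_int m) / \<omega>1"
  have \<tau>: "\<omega>1 * \<tau> = b1 - a1 + 2 * pi * of_int m" using freq_not_zero by (simp add: \<tau>_def)
  show thesis
  proof (rule that)
    fix t
    have 1: "a1 + \<omega>1 * (t + \<tau>) = b1 + \<omega>1 * t + 2 * pi * of_int m"
      using \<tau> by (simp add: algebra_simps)
    have "\<omega>2 * \<tau> = \<theta> * (b1 - a1 + 2 * pi * of_int m)"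
      unfolding \<omega>2 \<tau>[symmetric] by simp
    moreover have "2 * pi * \<alpha> = b2 - a2 - \<theta> * (b1 - a1)" by (simp add: \<alpha>_def)
    ultimately have 2: "a2 + \<omega>2 * (t + \<tau>) =
        (b2 + \<omega>2 * t + 2 * pi * (of_int m * \<theta> - of_int n - \<alpha>)) + 2 * pi * of_int n"
      by (simp add: algebra_simps)
    have "\<bar>2 * pi * w\<bar> < d" if "\<bar>w\<bar> < d / (2 * pi)" for w
      using that by (simp add: abs_mult field_simps)
    from this[OF mn] have "\<bar>2 * pi * (of_int m * \<theta> - of_int n - \<alpha>)\<bar> < d" .
    then show "dist (\<Phi> (a1 + \<omega>1 * (t + \<tau>), a2 + \<omega>2 * (t + \<tau>))) (\<Phi> (b1 + \<omega>1 * t, b2 + \<omega>2 * t)) < \<epsilon>"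
      unfolding 1 2 \<Phi>_shift using d(1) by (intro d(2)) auto
  qed
qed

text \<open>The orbit of \<open>z\<close> itself does not return, so over the compact time range it
  keeps a distance \<mu> from \<open>z\<close>. A solution starting within \<rho> of
  \<open>z\<close> shadows that orbit up to \<mu>\<open>/ 2\<close>, hence is still
  \<mu>\<open>/ 2\<close> away from \<open>z\<close>.\<close>

lemma no_early_return:
  assumes x: "gc_solution x" "\<And>t. x t \<in> level_set h k" and z: "z \<in> T" and \<delta>: "\<delta> > 0"
  obtains \<rho> where "\<rho> > 0"
    "\<And>t s. \<delta> \<le> s \<Longrightarrow> s \<le> N \<Longrightarrow> dist (x t) z < \<rho> \<Longrightarrow> dist (x (t + s)) z \<ge> \<rho>"
proof -
  obtain b1 b2 where b: "z = \<Phi> (b1, b2)" using z range_\<Phi> by (metis imageE surj_pair)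
  define \<zeta> where "\<zeta> = (\<lambda>t. \<Phi> (b1 + \<omega>1 * t, b2 + \<omega>2 * t))"
  \<comment> \<open>Keeps the time interval nonempty even if \<open>N\<close> is less than \<delta>,
    so that the minimum is attained.\<close>
  define M where "M = max \<delta> N"
  have "continuous_on {\<delta>..M} (\<lambda>s. dist (\<zeta> s) z)"
    unfolding \<zeta>_def
    by (intro continuous_intros continuous_on_compose2[OF \<Phi>_continuous[of UNIV]]) auto
  then obtain s0 where s0: "s0 \<in> {\<delta>..M}" "\<And>s. s \<in> {\<delta>..M} \<Longrightarrow> dist (\<zeta> s0) z \<le> dist (\<zeta> s) z"
    using continuous_attains_inf[of "{\<delta>..M}" "\<lambda>s. dist (\<zeta> s) z"] by (auto simp: M_def)
  define \<mu> where "\<mu> = dist (\<zeta> s0) z"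
  have \<mu>: "\<mu> > 0"
    using not_periodic[of b1 s0 b2] s0(1) \<delta> by (auto simp: \<mu>_def \<zeta>_def b)
  define L where "L = 16 * (3 * \<bar>h\<bar> + 9) + 2"
  define \<rho> where "\<rho> = \<mu> / (2 * exp (L * M))"
  have LM: "L * M \<ge> 0" using \<delta> by (simp add: L_def M_def)
  have "\<rho> > 0" using \<mu> by (simp add: \<rho>_def)
  moreover have "dist (x (t + s)) z \<ge> \<rho>" if s: "\<delta> \<le> s" "s \<le> N" and t: "dist (x t) z < \<rho>" for t s
  proof -
    have "dist (x (t + s)) (\<zeta> s) \<le> exp (L * \<bar>s\<bar>) * dist (x (t + 0)) (\<zeta> 0)"
      unfolding L_def \<zeta>_def
      by (rule gc_solution_dist[OF gc_solution_shift[OF x(1)] \<Phi>_solution x(2) \<Phi>_level_set])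
    also have "\<dots> \<le> exp (L * M) * \<rho>"
      using s t \<delta> by (intro mult_mono) (auto simp: L_def M_def \<zeta>_def b intro!: mult_left_mono)
    also have "\<dots> = \<mu> / 2" by (simp add: \<rho>_def)
    finally have "dist (x (t + s)) (\<zeta> s) \<le> \<mu> / 2" .
    moreover have "\<mu> \<le> dist (\<zeta> s) z" using s0(2)[of s] s by (simp add: \<mu>_def M_def)
    moreover have "\<rho> \<le> \<mu> / 2"
      unfolding \<rho>_def using \<mu> LM by (intro frac_le) auto
    ultimately show ?thesis
      using dist_triangle[of "\<zeta> s" z "x (t + s)"] by (simp add: dist_commute)
  qed
  ultimately show thesis by (rule that)
qed

end

section \<open>Poles of a torus, and cancellation over a window\<close>

fun horizontal_norm2 :: "state \<Rightarrow> real" where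
  "horizontal_norm2 (p, q, r, g1, g2, g3) = g1\<^sup>2 + g2\<^sup>2"

lemma horizontal_norm2_mirror [simp]: "horizontal_norm2 (mirror y) = horizontal_norm2 y"
  by (cases y) simp

lemma horizontal_norm2_nonneg: "horizontal_norm2 y \<ge> 0"
  by (cases y) simp

lemma continuous_on_horizontal_norm2: "continuous_on A horizontal_norm2"
proof -
  have eq: "horizontal_norm2 = (\<lambda>(p, q, r, g1, g2, g3). g1\<^sup>2 + g2\<^sup>2)" by auto
  show ?thesis unfolding eq split_beta by (intro continuous_intros)
qed

lemma continuous_on_node_rate:
  assumes "\<And>y. y \<in> A \<Longrightarrow> horizontal_norm2 y \<noteq> 0"
  shows "continuous_on A node_rate"
proof -
  have eq: "node_rate = (\<lambda>y. (case y of (p, q, r, g1, g2, g3) \<Rightarrow> p * g1 + q * g2) / horizontal_norm2 y)"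
    by auto
  show ?thesis
    unfolding eq split_beta
    by (intro continuous_intros continuous_on_horizontal_norm2) (use assms in auto)
qed

text \<open>At a pole the area integral forces \<open>r = 0\<close>, then \<open>k\<close> gives
  \<open>p = - k * g3\<close> and the energy gives \<open>q^2\<close>; two signs remain, so there
  are at most four points.\<close>

lemma finite_poles: "finite {z \<in> level_set h k. horizontal_norm2 z = 0}"
proof -
  define c where "c = h / 2 - k\<^sup>2"
  have "{z \<in> level_set h k. horizontal_norm2 z = 0} \<subseteq>
      (\<lambda>(s, q). (- k * s, q, 0, 0, 0, s)) ` ({1, -1} \<times> {sqrt c, - sqrt c})"
  proof
    fix z assume z: "z \<in> {z \<in> level_set h k. horizontal_norm2 z = 0}"
    obtain p q r g1 g2 g3 where z_eq: "z = (p, q, r, g1, g2, g3)" by (cases z)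
    have g: "g1 = 0" "g2 = 0" using z by (auto simp: z_eq sum_power2_eq_zero_iff)
    have eqs: "2 * (p\<^sup>2 + q\<^sup>2) + r\<^sup>2 / 2 = h" "r * g3 = 0" "r * (p\<^sup>2 + q\<^sup>2) - p * g3 = k" "g3\<^sup>2 = 1"
      using z by (auto simp: z_eq level_set_def g)
    have g3: "g3 = 1 \<or> g3 = -1" using eqs(4) by (simp add: power2_eq_1_iff)
    then have r: "r = 0" using eqs(2) by auto
    have p: "p = - k * g3" using eqs(3) g3 r by auto
    have "p\<^sup>2 = k\<^sup>2" using g3 by (auto simp: p)
    then have "q\<^sup>2 = c" using eqs(1) r by (simp add: c_def field_simps)
    then have "q = sqrt c \<or> q = - sqrt c" by (metis real_sqrt_abs abs_if minus_minus)
    then show "z \<in> (\<lambda>(s, q). (- k * s, q, 0, 0, 0, s)) ` ({1, -1} \<times> {sqrt c, - sqrt c})"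
      using g3 unfolding z_eq g r p by (intro image_eqI[of _ _ "(g3, q)"]) auto
  qed
  then show ?thesis by (rule finite_subset) auto
qed

lemma uniform_positive_radius:
  assumes "finite Z" "\<And>z. z \<in> Z \<Longrightarrow> \<exists>\<rho>>0. \<forall>\<rho>'. 0 < \<rho>' \<longrightarrow> \<rho>' \<le> \<rho> \<longrightarrow> Q z \<rho>'"
  shows "\<exists>\<rho>>0 :: real. \<forall>z\<in>Z. Q z \<rho>"
proof -
  obtain R where R: "\<And>z. z \<in> Z \<Longrightarrow> R z > 0 \<and> (\<forall>\<rho>'. 0 < \<rho>' \<longrightarrow> \<rho>' \<le> R z \<longrightarrow> Q z \<rho>')"
    using assms(2) by metis
  \<comment> \<open>The element 1 covers an empty \<open>Z\<close>: a torus may contain no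
    pole.\<close>
  define \<rho> where "\<rho> = Min (insert 1 (R ` Z))"
  have "\<rho> > 0" unfolding \<rho>_def using assms(1) R by (subst Min_gr_iff) auto
  moreover have "\<rho> \<le> R z" if "z \<in> Z" for z
    unfolding \<rho>_def using assms(1) that by (intro Min_le) auto
  ultimately show ?thesis using R by blast
qed

locale gc_quasiperiodic =
  gc_motion x h k p q r g1 g2 g3 + irrational_winding T h k \<Phi> \<omega>1 \<omega>2
  for x h k p q r g1 g2 g3 T \<Phi> \<omega>1 \<omega>2 +
  assumes T_eq: "T = connected_component_set (level_set h k) (x 0)"
begin

lemma x_in_T: "x t \<in> T"
proof -
  have "continuous_on UNIV x"
    using sol unfolding gc_solution_def
    by (metis continuous_at_imp_continuous_on has_vector_derivative_continuous)
  then have "connected (range x)" by (intro connected_continuous_image) auto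
  then have "range x \<subseteq> T"
    unfolding T_eq using lev by (intro connected_component_maximal) auto
  then show ?thesis by auto
qed

lemma mirror_in_T:
  assumes "y \<in> T"
  shows "mirror y \<in> T"
proof -
  have "connected_component (level_set h k) y (mirror y)"
    using assms T_sub k by (intro connected_component_mirror) auto
  then show ?thesis using assms unfolding T_eq by (auto intro: connected_component_trans)
qed

lemma compact_T: "compact T"
proof -
  have "closed T" unfolding T_eq
    by (intro closed_connected_component compact_imp_closed compact_level_set)
  then show ?thesis
    using T_sub compact_level_set by (metis closed_Int_compact inf.absorb_iff1)
qed

text \<open>Both \<open>x\<close> and its mirror image solve the equations on the same torus, so
  they are windings with the same frequencies. This is where the invariance of the component
  enters.\<close>

lemma recurrence_mirror:
  assumes "\<epsilon> > 0"
  obtains \<tau> where "\<And>t. dist (x (t + \<tau>)) (mirror (x t)) < \<epsilon>"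
proof -
  obtain a1 a2 where a: "\<And>t. x t = \<Phi> (a1 + \<omega>1 * t, a2 + \<omega>2 * t)"
    by (rule solution_angles[OF sol lev x_in_T]) (rule that)
  obtain b1 b2 where b: "\<And>t. mirror (x t) = \<Phi> (b1 + \<omega>1 * t, b2 + \<omega>2 * t)"
    by (rule solution_angles[OF gc_solution_mirror[OF sol] _ mirror_in_T[OF x_in_T]])
      (use lev in \<open>simp add: level_set_mirror\<close>, rule that)
  obtain \<tau> where "\<And>t. dist (\<Phi> (a1 + \<omega>1 * (t + \<tau>), a2 + \<omega>2 * (t + \<tau>)))
      (\<Phi> (b1 + \<omega>1 * t, b2 + \<omega>2 * t)) < \<epsilon>"
    by (rule uniform_recurrence[OF assms]) (rule that)
  then have "dist (x (t + \<tau>)) (mirror (x t)) < \<epsilon>" for t unfolding b unfolding a by blast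
  then show thesis by (rule that)
qed

definition "poles = {z \<in> T. horizontal_norm2 z = 0}"

lemma finite_poles_T: "finite poles"
  using T_sub unfolding poles_def by (intro finite_subset[OF _ finite_poles[of h k]]) auto

lemma separated_returns:
  assumes \<delta>: "\<delta> > 0"
  obtains \<rho> where "\<rho> > 0"
    "\<And>z t t'. z \<in> poles \<Longrightarrow> dist (x t) z < \<rho> \<Longrightarrow> dist (x t') z < \<rho> \<Longrightarrow> \<bar>t - t'\<bar> \<le> N \<Longrightarrow> \<bar>t - t'\<bar> < \<delta>"
proof -
  define Q where "Q z \<rho> \<longleftrightarrow> (\<forall>t t'. dist (x t) z < \<rho> \<longrightarrow> dist (x t') z < \<rho> \<longrightarrow> \<bar>t - t'\<bar> \<le> N \<longrightarrow> \<bar>t - t'\<bar> < \<delta>)"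
    for z \<rho>
  have "\<exists>\<rho>>0. \<forall>\<rho>'. 0 < \<rho>' \<longrightarrow> \<rho>' \<le> \<rho> \<longrightarrow> Q z \<rho>'" if "z \<in> poles" for z
  proof -
    have z: "z \<in> T" using that by (simp add: poles_def)
    obtain \<rho> where \<rho>: "\<rho> > 0"
      "\<And>t s. \<delta> \<le> s \<Longrightarrow> s \<le> N \<Longrightarrow> dist (x t) z < \<rho> \<Longrightarrow> dist (x (t + s)) z \<ge> \<rho>"
      by (rule no_early_return[OF sol lev z \<delta>]) (rule that)
    have "Q z \<rho>'" if "\<rho>' \<le> \<rho>" for \<rho>'
      unfolding Q_def
    proof (intro allI impI)
      fix t t' assume t: "dist (x t) z < \<rho>'" "dist (x t') z < \<rho>'" and N: "\<bar>t - t'\<bar> \<le> N"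
      have "t' - t < \<delta>" using \<rho>(2)[of "t' - t" t] t that N by force
      moreover have "t - t' < \<delta>" using \<rho>(2)[of "t - t'" t'] t that N by force
      ultimately show "\<bar>t - t'\<bar> < \<delta>" by linarith
    qed
    then show ?thesis using \<rho>(1) by blast
  qed
  then obtain \<rho> where "\<rho> > 0" "\<forall>z\<in>poles. Q z \<rho>"
    using uniform_positive_radius[OF finite_poles_T, of Q] by blast
  then show thesis unfolding Q_def by (intro that[of \<rho>]) blast+
qed

lemma precession_rate_horizontal:
  assumes "horizontal_norm2 (x t) \<noteq> 0"
  shows "precession_rate x t = node_rate (x t)"
proof -
  have "Y t \<noteq> 0" using assms by (simp add: x_eq Y_def)
  then show ?thesis by (simp add: precession_rate_regular node_rate_eq)
qed

text \<open>Away from the poles \<open>node_rate\<close> is uniformly continuous, and it is odd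
  under \<open>mirror\<close>. Only \<open>x t\<close> is required to avoid the poles:
  \<open>mirror\<close> preserves \<open>horizontal_norm2\<close>, so the nearby point
  \<open>x (t +\<close> \<tau>\<open>)\<close> avoids them as well.\<close>

lemma precession_rate_cancellation:
  assumes \<rho>: "\<rho> > 0" and \<eta>: "\<eta> > 0"
  shows "\<exists>\<tau>. \<forall>t. (\<forall>z\<in>poles. dist (x t) z \<ge> \<rho>) \<longrightarrow>
    \<bar>precession_rate x t + precession_rate x (t + \<tau>)\<bar> \<le> \<eta>"
proof -
  define K1 where "K1 = T - (\<Union>z\<in>poles. ball z \<rho>)"
  have "compact K1" unfolding K1_def by (intro compact_diff compact_T) auto
  have "\<exists>\<kappa>>0. \<forall>y\<in>K1. \<kappa> \<le> horizontal_norm2 y"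
  proof (cases "K1 = {}")
    case False
    then obtain y0 where y0: "y0 \<in> K1" "\<And>y. y \<in> K1 \<Longrightarrow> horizontal_norm2 y0 \<le> horizontal_norm2 y"
      using continuous_attains_inf[OF \<open>compact K1\<close> _ continuous_on_horizontal_norm2] by blast
    have "y0 \<notin> poles" using y0(1) \<rho> unfolding K1_def by auto
    then have "horizontal_norm2 y0 > 0"
      using y0(1) horizontal_norm2_nonneg[of y0] by (auto simp: poles_def K1_def)
    then show ?thesis using y0(2) by blast
  qed (auto intro: exI[of _ 1])
  then obtain \<kappa> where \<kappa>: "\<kappa> > 0" "\<And>y. y \<in> K1 \<Longrightarrow> \<kappa> \<le> horizontal_norm2 y" by blast
  \<comment> \<open>Halving \<kappa> leaves room for \<open>x (t +\<close> \<tau>\<open>)\<close>,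
    which is close to a point with value at least \<kappa> but need not reach \<kappa>
    itself.\<close>
  define K2 where "K2 = {y \<in> T. \<kappa> / 2 \<le> horizontal_norm2 y}"
  have "K2 = T \<inter> horizontal_norm2 -` {\<kappa> / 2..}" by (auto simp: K2_def)
  then have "compact K2"
    using continuous_closed_preimage[OF continuous_on_horizontal_norm2 compact_imp_closed[OF compact_T]]
      compact_T by (metis closed_Int_compact closed_atLeast inf_commute inf_left_idem)
  then have "uniformly_continuous_on K2 node_rate"
    using \<kappa>(1) by (intro compact_uniformly_continuous continuous_on_node_rate) (auto simp: K2_def)
  then obtain d1 where d1: "d1 > 0"
    "\<And>u v. u \<in> K2 \<Longrightarrow> v \<in> K2 \<Longrightarrow> dist v u < d1 \<Longrightarrow> dist (node_rate v) (node_rate u) < \<eta>"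
    unfolding uniformly_continuous_on_def using \<eta> by metis
  have "uniformly_continuous_on T horizontal_norm2"
    by (intro compact_uniformly_continuous continuous_on_horizontal_norm2 compact_T)
  then obtain d2 where d2: "d2 > 0"
    "\<And>u v. u \<in> T \<Longrightarrow> v \<in> T \<Longrightarrow> dist v u < d2 \<Longrightarrow> dist (horizontal_norm2 v) (horizontal_norm2 u) < \<kappa> / 2"
    unfolding uniformly_continuous_on_def using \<kappa>(1) by (metis half_gt_zero)
  obtain \<tau> where \<tau>: "\<And>t. dist (x (t + \<tau>)) (mirror (x t)) < min d1 d2"
    using recurrence_mirror[of "min d1 d2"] d1(1) d2(1) by auto
  show ?thesis
  proof (intro exI[of _ \<tau>] allI impI)
    fix t assume "\<forall>z\<in>poles. dist (x t) z \<ge> \<rho>"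
    then have "x t \<in> K1" using x_in_T by (auto simp: K1_def dist_commute not_less)
    then have xt: "horizontal_norm2 (x t) \<ge> \<kappa>" by (rule \<kappa>(2))
    have "dist (horizontal_norm2 (x (t + \<tau>))) (horizontal_norm2 (mirror (x t))) < \<kappa> / 2"
      using \<tau>[of t] by (intro d2(2) x_in_T mirror_in_T) auto
    then have xs: "horizontal_norm2 (x (t + \<tau>)) \<ge> \<kappa> / 2"
      using xt unfolding dist_real_def horizontal_norm2_mirror by linarith
    have "dist (node_rate (x (t + \<tau>))) (node_rate (mirror (x t))) < \<eta>"
      using \<tau>[of t] xt xs \<kappa>(1) by (intro d1(2)) (auto simp: K2_def x_in_T mirror_in_T)
    moreover have "precession_rate x t = node_rate (x t)"
      "precession_rate x (t + \<tau>) = node_rate (x (t + \<tau>))"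
      using xt xs \<kappa>(1) by (intro precession_rate_horizontal; simp)+
    ultimately show "\<bar>precession_rate x t + precession_rate x (t + \<tau>)\<bar> \<le> \<eta>"
      by (simp add: dist_real_def node_rate_mirror)
  qed
qed

lemma few_visits:
  assumes \<delta>: "\<delta> > 0"
    and sep: "\<And>t t'. dist (x t) z < \<rho> \<Longrightarrow> dist (x t') z < \<rho> \<Longrightarrow> \<bar>t - t'\<bar> \<le> real L * \<delta> \<Longrightarrow> \<bar>t - t'\<bar> < \<delta>"
  shows "card {n. n < L \<and> (\<exists>t\<in>{u + real n * \<delta>..u + real n * \<delta> + \<delta>}. dist (x t) z < \<rho>)} \<le> 3"
    (is "card ?B \<le> 3")
proof (cases "?B = {}")
  case False
  then obtain n0 where n0: "n0 \<in> ?B" by blast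
  then obtain t0 where t0: "t0 \<in> {u + real n0 * \<delta>..u + real n0 * \<delta> + \<delta>}" "dist (x t0) z < \<rho>" by auto
  \<comment> \<open>Two visits in the window are less than \<delta> apart, so their cells are equal
    or adjacent. Truncated subtraction at \<open>n0 = 0\<close> only shortens the interval to
    \<open>{0..1}\<close>, which is still correct.\<close>
  have "?B \<subseteq> {n0 - 1..n0 + 1}"
  proof
    fix n assume n: "n \<in> ?B"
    then obtain t where t: "t \<in> {u + real n * \<delta>..u + real n * \<delta> + \<delta>}" "dist (x t) z < \<rho>" by auto
    have range: "u \<le> s \<and> s \<le> u + real L * \<delta>"
      if "s \<in> {u + real j * \<delta>..u + real j * \<delta> + \<delta>}" "j < L" for s j
    proof -
      have "0 \<le> real j * \<delta>" using \<delta> by simp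
      moreover have "(real j + 1) * \<delta> \<le> real L * \<delta>" using that(2) \<delta> by (intro mult_right_mono) auto
      then have "real j * \<delta> + \<delta> \<le> real L * \<delta>" by (simp add: algebra_simps)
      ultimately show ?thesis using that(1) unfolding atLeastAtMost_iff by linarith
    qed
    have "\<bar>t - t0\<bar> \<le> real L * \<delta>"
      using range[OF t(1)] range[OF t0(1)] n n0 by auto
    then have lt: "\<bar>t - t0\<bar> < \<delta>" by (rule sep[OF t(2) t0(2)])
    have "real n * \<delta> < real n0 * \<delta> + 2 * \<delta>" "real n0 * \<delta> < real n * \<delta> + 2 * \<delta>"
      using lt t(1) t0(1) by auto
    then have "real n * \<delta> < (real n0 + 2) * \<delta>" "real n0 * \<delta> < (real n + 2) * \<delta>"
      by (simp_all add: algebra_simps)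
    then have "real n < real n0 + 2" "real n0 < real n + 2"
      using \<delta> by (simp_all only: mult_less_cancel_right_pos)
    then show "n \<in> {n0 - 1..n0 + 1}" by auto
  qed
  then have "card ?B \<le> card {n0 - 1..n0 + 1}" by (intro card_mono) auto
  then show ?thesis by simp
next
  case True
  then show ?thesis by (simp only: card.empty)
qed

text \<open>A cell that avoids all \<rho>-balls contributes at most \<eta>\<open>*\<close>\<delta>.
  Each pole spoils at most 3 cells, and a spoiled cell costs at most \<open>2 * C\<close>, one
  \<open>C\<close> for each of the two terms of \<open>Q\<close>; hence the factor 6. The error term
  is free of \<open>L\<close> and \<eta>, although \<rho> and \<tau> depend on them.\<close>

lemma precession_window:
  assumes P: "\<And>t. (P has_real_derivative precession_rate x t) (at t)"
    and \<delta>: "\<delta> > 0" and inc: "\<And>t s. 0 \<le> s \<Longrightarrow> s \<le> \<delta> \<Longrightarrow> \<bar>P (t + s) - P t\<bar> \<le> C"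
    and \<eta>: "\<eta> > 0"
  shows "\<exists>\<tau>. \<forall>u. \<bar>P (u + real L * \<delta>) + P (u + real L * \<delta> + \<tau>) - (P u + P (u + \<tau>))\<bar>
    \<le> \<eta> * (real L * \<delta>) + 6 * C * card poles"
proof -
  obtain \<rho> where \<rho>: "\<rho> > 0"
    "\<And>z t t'. z \<in> poles \<Longrightarrow> dist (x t) z < \<rho> \<Longrightarrow> dist (x t') z < \<rho> \<Longrightarrow> \<bar>t - t'\<bar> \<le> real L * \<delta> \<Longrightarrow> \<bar>t - t'\<bar> < \<delta>"
    by (rule separated_returns[OF \<delta>, of "real L * \<delta>"]) (rule that)
  obtain \<tau> where \<tau>: "\<And>t. (\<forall>z\<in>poles. dist (x t) z \<ge> \<rho>) \<Longrightarrow>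
    \<bar>precession_rate x t + precession_rate x (t + \<tau>)\<bar> \<le> \<eta>"
    using precession_rate_cancellation[OF \<rho>(1) \<eta>] by blast
  define Q where "Q t = P t + P (t + \<tau>)" for t
  have C0: "C \<ge> 0" using inc[of 0 0] \<delta> by simp
  have dQ: "(Q has_real_derivative precession_rate x t + precession_rate x (t + \<tau>)) (at t)" for t
    unfolding Q_def[abs_def] using P[of "t + \<tau>"] by (intro DERIV_add P) (simp add: DERIV_shift)
  have "\<bar>Q (u + real L * \<delta>) - Q u\<bar> \<le> \<eta> * (real L * \<delta>) + 6 * C * card poles" for u
  proof -
    define B where "B z = {n. n < L \<and> (\<exists>t\<in>{u + real n * \<delta>..u + real n * \<delta> + \<delta>}. dist (x t) z < \<rho>)}" for z
    define bad where "bad = (\<Union>z\<in>poles. B z)"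
    have bad_L: "bad \<subseteq> {..<L}" by (auto simp: bad_def B_def)
    have "card bad \<le> (\<Sum>z\<in>poles. card (B z))" unfolding bad_def by (intro card_UN_le finite_poles_T)
    also have "\<dots> \<le> (\<Sum>z\<in>poles. 3)"
      unfolding B_def using \<delta> \<rho>(2) by (intro sum_mono few_visits) blast+
    finally have card_bad: "card bad \<le> 3 * card poles" by simp
    have seg: "\<bar>Q (u + real (Suc n) * \<delta>) - Q (u + real n * \<delta>)\<bar> \<le> \<eta> * \<delta> + (if n \<in> bad then 2 * C else 0)"
      if n: "n < L" for n
    proof -
      define v where "v = u + real n * \<delta>"
      have v: "u + real (Suc n) * \<delta> = v + \<delta>" by (simp add: v_def algebra_simps)
      show ?thesis
      proof (cases "n \<in> bad")
        case True
        have "\<bar>P (v + \<delta>) - P v\<bar> \<le> C" "\<bar>P (v + \<tau> + \<delta>) - P (v + \<tau>)\<bar> \<le> C"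
          using \<delta> by (intro inc; simp)+
        moreover have comm: "v + \<delta> + \<tau> = v + \<tau> + \<delta>" by simp
        moreover have "0 \<le> \<eta> * \<delta>" using \<eta> \<delta> by simp
        ultimately show ?thesis
          unfolding v Q_def v_def[symmetric] comm if_P[OF True] by linarith
      next
        case False
        have "\<bar>Q (v + \<delta>) - Q v\<bar> \<le> \<eta> * (v + \<delta> - v)"
        proof (rule mvt_abs_bound[OF _ dQ \<tau>])
          fix t assume "t \<in> {v..v + \<delta>}"
          then show "\<forall>z\<in>poles. \<rho> \<le> dist (x t) z"
            using False n unfolding bad_def B_def v_def by (force simp: not_less)
        qed (use \<delta> in simp)
        then show ?thesis using False unfolding v v_def[symmetric] by simp
      qed
    qed
    have "Q (u + real L * \<delta>) - Q u = (\<Sum>n<L. Q (u + real (Suc n) * \<delta>) - Q (u + real n * \<delta>))"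
      by (subst sum_lessThan_telescope) simp
    also have "\<bar>\<dots>\<bar> \<le> (\<Sum>n<L. \<eta> * \<delta> + (if n \<in> bad then 2 * C else 0))"
      by (rule order_trans[OF sum_abs sum_mono]) (use seg in auto)
    also have "\<dots> = real L * (\<eta> * \<delta>) + 2 * C * card bad"
      using bad_L by (simp add: sum.distrib sum.If_cases Int_absorb1)
    also have "\<dots> \<le> real L * (\<eta> * \<delta>) + 2 * C * (3 * card poles)"
      using card_bad C0 by (intro add_left_mono mult_left_mono) auto
    finally show ?thesis by (simp add: mult_ac)
  qed
  then show ?thesis unfolding Q_def by blast
qed

lemma precession_sublinear:
  assumes P: "\<And>t. (P has_real_derivative precession_rate x t) (at t)"
  shows "((\<lambda>t. P t / t) \<longlongrightarrow> 0) at_top"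
proof -
  obtain \<delta> C where \<delta>: "\<delta> > 0" and inc: "\<And>t s. 0 \<le> s \<Longrightarrow> s \<le> \<delta> \<Longrightarrow> \<bar>P (t + s) - P t\<bar> \<le> C"
    by (rule increment_bound[OF P]) (rule that)
  show ?thesis
    by (rule sublinear_of_windows[OF \<delta> inc]) (auto intro: precession_window[OF P \<delta> inc])
qed

end

theorem proposition5:
  fixes x :: "real \<Rightarrow> state" and h k :: real
    and \<Phi> :: "real \<times> real \<Rightarrow> state" and \<omega>1 \<omega>2 :: real
    and t0 \<psi>0 :: real
  assumes "gc_solution x"
    and "\<And>t. geometric_integral (x t) = 1"
    and "\<And>t. area_integral (x t) = 0"
    and "\<And>t. energy (x t) = h"
    and "\<And>t. gc_integral (x t) = k"
    and "h \<noteq> 2 * k\<^sup>2"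
    and "k \<noteq> 0"
    and "h \<noteq> 3 / 2 * \<bar>2 * k\<bar> powr (2 / 3) + 1"
    and "h \<noteq> 3 / 2 * \<bar>2 * k\<bar> powr (2 / 3) - 1"
    and "angle_coordinates (connected_component_set (level_set h k) (x 0)) \<Phi> \<omega>1 \<omega>2"
    and "rationally_independent \<omega>1 \<omega>2"
  shows "has_main_motion (precession_angle x t0 \<psi>0) 0
       \<and> ((\<lambda>t. precession_angle x t0 \<psi>0 t / t) \<longlongrightarrow> 0) at_top"
proof -
  obtain p q r g1 g2 g3 where x: "x = (\<lambda>t. (p t, q t, r t, g1 t, g2 t, g3 t))"
    by (rule state_components)
  interpret gc_quasiperiodic x h k p q r g1 g2 g3
      "connected_component_set (level_set h k) (x 0)" \<Phi> \<omega>1 \<omega>2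
    using assms x by unfold_locales (auto simp: level_set_def connected_component_subset)
  have "(precession_angle x t0 \<psi>0 has_real_derivative precession_rate x t) (at t)" for t
    unfolding precession_angle_def[abs_def]
    by (rule DERIV_add[OF DERIV_const, simplified add_0]) (rule has_real_derivative_LBINT isCont_precession_rate)+
  then have "((\<lambda>t. precession_angle x t0 \<psi>0 t / t) \<longlongrightarrow> 0) at_top"
    by (rule precession_sublinear)
  then show ?thesis using has_main_motion_zero by blast
qed

end
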